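(* Let $2<\alpha<4$, $c>0$, $y\in(0,\infty)$, and let $$C(z,w)=\int_{t,s>0} \frac{\partial}{\partial z}\frac{\partial}{\partial w}\mathcal L(z,t,w,s)\,dt\,ds$$ with $\mathcal L$ as defined in the context. Then for all $z,w\in\mathbb C\setminus\mathbb R$, $$C(z,w)=-y\,c\,\Gamma\Bigl(1+\frac\alpha2\Bigr)\,\frac{\partial}{\partial z}\bigl(z m_y(z)\bigr)\,\frac{\partial}{\partial w}\bigl(w m_y(w)\bigr)\times\frac{\bigl(-1+zm_y(z)\bigr)^{\alpha/2-1}-\bigl(-1+wm_y(w)\bigr)^{\alpha/2-1}}{zm_y(z)-wm_y(w)}.$$
   Context: $C(z,w)$ is the limiting covariance kernel of $N^{\alpha/4-1}\bigl(\operatorname{Tr}(z-\mathbf A_N)^{-1}-\mathbb E\operatorname{Tr}(z-\mathbf A_N)^{-1}\bigr)$, where $\mathbf A_N=\mathbf X_N\mathbf X_N^*/N$ and $\mathbf X_N$ is a $P\times N$ matrix, $P/N\to y\in(0,\infty)$, with i.i.d. centred entries of variance one satisfying $\mathbb P(|x_{ij}|>x)=\frac{-c\,\ell_0(x)}{\Gamma(1-\alpha/2)\,x^{\alpha}}$ for $x>0$, with $2<\alpha<4$, $c>0$ a constant and $\ell_0$ a slowly varying function with $\ell_0(x)\to1$ as $x\to\infty$. This $c$ is the constant in the formulas. $\mathrm{sgn}_z$ is the sign of $\operatorname{Im}z$ and $\mathbf i$ is the imaginary unit. $m_y(z)=\int_{\mathbb R}\frac{\mu_{\mathrm{MP},y}(dx)}{z-x}$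 is the Stieltjes transform of the Marchenko–Pastur law $\mu_{\mathrm{MP},y}(dx)=\frac{\sqrt{(b-x)(x-a)}}{2\pi x y}\mathbf 1_{[a,b]}(x)\,dx+\mathbf 1_{y>1}\bigl(1-\frac1y\bigr)\delta_0(dx)$, with $a=(1-\sqrt y)^2$, $b=(1+\sqrt y)^2$; it satisfies $zy\,m_y(z)^2+(1-z-y)m_y(z)+1=0$. For $t,s>0$: $$K(z,t)=\mathbf i\,t\,\mathrm{sgn}_z\,z\,m_y(z),$$ $$\ell(z,t,w,s)=c\,\frac{(K(z,t)+K(w,s))^{\alpha/2}-K(z,t)^{\alpha/2}-K(w,s)^{\alpha/2}}{ts},$$ $$r(z,t,w,s)=\exp\bigl(-yK(z,t)-yK(w,s)\bigr),$$ $$\mathcal L(z,t,w,s)=y\,\exp\bigl(\mathbf i\,\mathrm{sgn}_z\,tz+\mathbf i\,\mathrm{sgn}_w\,sw\bigr)\,\ell(z,t,w,s)\,r(z,t,w,s).$$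
   Formalization: The powers have base 1-z m_y(z) and 1-w m_y(w) instead of -1+z m_y(z) and -1+w m_y(w), since the printed formula is false (negative at w = conj z, where C > 0); at z=w, where the quotient is 0/0, the formula is read as its limit. *)

theory Defs
  imports "HOL-Analysis.Analysis"
begin

section \<open>The Marchenko--Pastur law and its Stieltjes transform\<close>

definition mp_density :: "real \<Rightarrow> real \<Rightarrow> real" where
  "mp_density y x =
     (let a = (1 - sqrt y)\<^sup>2; b = (1 + sqrt y)\<^sup>2
      in sqrt ((b - x) * (x - a)) / (2 * pi * x * y) * indicator {a..b} x)"

definition mp_law :: "real \<Rightarrow> real measure" where
  "mp_law y = measure_of UNIV (sets borel)
     (\<lambda>A. (\<integral>\<^sup>+x\<in>A. ennreal (mp_density y x) \<partial>lborel) +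
          (if y > 1 then ennreal (1 - 1 / y) * indicator A 0 else 0))"

definition mp_stieltjes :: "real \<Rightarrow> complex \<Rightarrow> complex" where
  "mp_stieltjes y z = (\<integral>x. 1 / (z - complex_of_real x) \<partial>mp_law y)"

lemma mp_density_measurable [measurable]: "mp_density y \<in> borel_measurable borel"
  unfolding mp_density_def Let_def by measurable

lemma space_mp_law [simp]: "space (mp_law y) = UNIV"
  unfolding mp_law_def by (rule space_measure_of) auto

lemma sets_mp_law [simp, measurable_cong]: "sets (mp_law y) = sets borel"
  unfolding mp_law_def using sets.sigma_sets_eq[of "borel :: real measure"] by simp

text \<open>The set function in the definition really is a measure, so that
  \<^const>\<open>measure_of\<close> does not fall back to the zero measure.\<close>

lemma emeasure_mp_law:
  assumes "A \<in> sets borel"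
  shows "emeasure (mp_law y) A =
    (\<integral>\<^sup>+x\<in>A. ennreal (mp_density y x) \<partial>lborel) +
    (if y > 1 then ennreal (1 - 1 / y) * indicator A 0 else 0)"
proof -
  let ?D = "density lborel (\<lambda>x. ennreal (mp_density y x))"
  let ?S = "scale_measure (if y > 1 then ennreal (1 - 1 / y) else 0) (distr (count_space {()}) borel (\<lambda>_. 0 :: real))"
  let ?\<mu> = "\<lambda>A. (\<integral>\<^sup>+x\<in>A. ennreal (mp_density y x) \<partial>lborel) +
          (if y > 1 then ennreal (1 - 1 / y) * indicator A 0 else 0)"
  have eq: "?\<mu> B = emeasure ?D B + emeasure ?S B" if "B \<in> sets borel" for B
    using that by (auto simp: emeasure_density emeasure_distr indicator_def)
  have ca: "countably_additive (sets borel) ?\<mu>"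
  proof (rule countably_additiveI)
    fix B :: "nat \<Rightarrow> real set"
    assume B: "range B \<subseteq> sets borel" "disjoint_family B" "(\<Union>i. B i) \<in> sets borel"
    have "(\<Sum>i. ?\<mu> (B i)) = (\<Sum>i. emeasure ?D (B i) + emeasure ?S (B i))"
      using B(1) by (intro suminf_cong eq) auto
    also have "\<dots> = (\<Sum>i. emeasure ?D (B i)) + (\<Sum>i. emeasure ?S (B i))"
      by (intro suminf_add[symmetric]) auto
    also have "(\<Sum>i. emeasure ?D (B i)) = emeasure ?D (\<Union>i. B i)"
      using B by (intro suminf_emeasure) auto
    also have "(\<Sum>i. emeasure ?S (B i)) = emeasure ?S (\<Union>i. B i)"
      using B by (intro suminf_emeasure) auto
    also have "emeasure ?D (\<Union>i. B i) + emeasure ?S (\<Union>i. B i) = ?\<mu> (\<Union>i. B i)"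
      using eq[OF B(3)] by simp
    finally show "(\<Sum>i. ?\<mu> (B i)) = ?\<mu> (\<Union>i. B i)" .
  qed
  show ?thesis
  proof (rule emeasure_measure_of[OF mp_law_def])
    show "positive (sets (mp_law y)) ?\<mu>"
      by (simp add: positive_def)
    show "countably_additive (sets (mp_law y)) ?\<mu>"
      using ca by simp
  qed (use assms in auto)
qed


section \<open>The limiting covariance kernel\<close>

text \<open>All complex powers below are principal branches (\<^const>\<open>powr\<close>).\<close>

definition kern_K :: "real \<Rightarrow> complex \<Rightarrow> real \<Rightarrow> complex" where
  "kern_K y z t = \<i> * complex_of_real t * complex_of_real (sgn (Im z)) * z * mp_stieltjes y z"

definition kern_l :: "real \<Rightarrow> real \<Rightarrow> real \<Rightarrow> complex \<Rightarrow> real \<Rightarrow> complex \<Rightarrow> real \<Rightarrow> complex" where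
  "kern_l \<alpha> c y z t w s =
     complex_of_real c *
     ((kern_K y z t + kern_K y w s) powr complex_of_real (\<alpha> / 2)
       - kern_K y z t powr complex_of_real (\<alpha> / 2)
       - kern_K y w s powr complex_of_real (\<alpha> / 2))
     / complex_of_real (t * s)"

definition kern_r :: "real \<Rightarrow> complex \<Rightarrow> real \<Rightarrow> complex \<Rightarrow> real \<Rightarrow> complex" where
  "kern_r y z t w s =
     exp (- complex_of_real y * kern_K y z t - complex_of_real y * kern_K y w s)"

definition kern_L :: "real \<Rightarrow> real \<Rightarrow> real \<Rightarrow> complex \<Rightarrow> real \<Rightarrow> complex \<Rightarrow> real \<Rightarrow> complex" where
  "kern_L \<alpha> c y z t w s =
     complex_of_real y *
     exp (\<i> * complex_of_real (sgn (Im z)) * complex_of_real t * z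
        + \<i> * complex_of_real (sgn (Im w)) * complex_of_real s * w)
     * kern_l \<alpha> c y z t w s * kern_r y z t w s"

definition cov_integrand ::
    "real \<Rightarrow> real \<Rightarrow> real \<Rightarrow> complex \<Rightarrow> complex \<Rightarrow> real \<times> real \<Rightarrow> complex" where
  "cov_integrand \<alpha> c y z w =
     (\<lambda>(t, s). deriv (\<lambda>z'. deriv (\<lambda>w'. kern_L \<alpha> c y z' t w' s) w) z)"

definition cov_kernel :: "real \<Rightarrow> real \<Rightarrow> real \<Rightarrow> complex \<Rightarrow> complex \<Rightarrow> complex" where
  "cov_kernel \<alpha> c y z w =
     set_lebesgue_integral lborel ({0<..} \<times> {0<..}) (cov_integrand \<alpha> c y z w)"

text \<open>
  The powers have base \<open>1 - z m(z)\<close>, not \<open>-1 + z m(z)\<close> as in the published formula, which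
  contains a sign error: with principal powers it differs from the integral \<^const>\<open>cov_kernel\<close>
  (the first power by the factor \<open>exp (- \<i> \<pi> (\<alpha>/2 - 1))\<close> for \<open>Im z > 0\<close> and by the conjugate
  factor for \<open>Im z < 0\<close>), and it is negative for \<open>w = cnj z\<close>, where the kernel is a limit of
  variances.  No other choice of branches removes the discrepancy.
  At \<open>z = w\<close> the quotient is 0/0, and the formula has to be read as its limit.
\<close>

definition cov_formula :: "real \<Rightarrow> real \<Rightarrow> real \<Rightarrow> complex \<Rightarrow> complex \<Rightarrow> complex" where
  "cov_formula \<alpha> c y z w =
     - complex_of_real (y * c * Gamma (1 + \<alpha> / 2))
     * deriv (\<lambda>z'. z' * mp_stieltjes y z') z
     * deriv (\<lambda>w'. w' * mp_stieltjes y w') w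
     * (((1 - z * mp_stieltjes y z) powr complex_of_real (\<alpha> / 2 - 1)
         - (1 - w * mp_stieltjes y w) powr complex_of_real (\<alpha> / 2 - 1))
        / (z * mp_stieltjes y z - w * mp_stieltjes y w))"

end

theory Submission
  imports Defs "HOL-Complex_Analysis.Complex_Analysis"
begin

text \<open>Write \<open>\<beta> = \<alpha> / 2\<close>, so \<open>1 < \<beta> < 2\<close>, and \<open>u(z) = 1 - z m(z)\<close>.  On each open half plane
  \<open>K(z,t) = t p(z)\<close> with \<open>p = \<i> sgn(Im z) z m(z)\<close>, and the exponentials in the integrand combine
  to \<open>exp (- t q(z) - s q(w))\<close> with \<open>q = y p - \<i> sgn(Im z) z\<close>.

  The difference of powers couples \<open>t\<close> and \<open>s\<close>.  The idea is to separate the variables.  For \<open>X\<close>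
  and \<open>Y\<close> in the right half plane, \<open>(X + Y)\<^sup>\<beta> - X\<^sup>\<beta> - Y\<^sup>\<beta>\<close> is, up to the factor
  \<open>\<beta> (\<beta> - 1) / \<Gamma>(2 - \<beta>)\<close>, the integral of
  \<open>\<tau> powr (- \<beta> - 1) * (1 - exp (- \<tau> X)) * (1 - exp (- \<tau> Y))\<close> over \<open>\<tau> > 0\<close>.  This follows from
  the Gamma integral with complex parameter by integrating by parts twice.  Hence the mixed
  derivative of the integrand is a \<open>\<tau>\<close>-integral of a product of a function of \<open>(z, t)\<close> and a
  function of \<open>(w, s)\<close>, each a combination of exponentials in \<open>t\<close> or \<open>s\<close>.  Fubini's theorem lets
  one integrate over \<open>t\<close> and \<open>s\<close> first.

  Each of these integrals becomes simple through the Marchenko--Pastur equation.  In terms of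
  \<open>u\<close> it reads \<open>y u\<^sup>2 + (z - 1 - y) u + 1 = 0\<close>, which says exactly that \<open>p = q u\<close>; the integral
  over \<open>t\<close> is then \<open>\<tau> u'(z) / (1 + \<tau> u(z))\<close>.  What remains is the integral of
  \<open>\<tau> powr (1 - \<beta>) / ((1 + \<tau> u) (1 + \<tau> v))\<close>, which partial fractions and the Beta integral
  evaluate to \<open>\<Gamma>(2 - \<beta>) \<Gamma>(\<beta> - 1) (u powr (\<beta> - 1) - v powr (\<beta> - 1)) / (u - v)\<close>.  The Gamma
  factors combine to \<open>\<Gamma>(1 + \<beta>)\<close>.

  The quotient makes sense for \<open>z \<noteq> w\<close> because the equation recovers \<open>z\<close> from \<open>u(z)\<close>, so that
  \<open>u\<close> is injective.  On the diagonal the last integral is still defined and depends continuously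
  on \<open>v\<close>, which gives the limit.

  The Marchenko--Pastur equation itself comes from a trigonometric parametrisation of the
  support: the Stieltjes integral turns into the integral of \<open>sin\<^sup>2 \<theta> / (Z - cos \<theta>)\<close> over
  \<open>[0, \<pi>]\<close>, which has an explicit antiderivative once \<open>2 Z = \<omega> + 1 / \<omega>\<close> with \<open>\<bar>\<omega>\<bar> < 1\<close>.  The
  same integral at real \<open>Z\<close> shows that the law has total mass one.\<close>

section \<open>Integrals depending on a parameter, and the half line\<close>

text \<open>Cauchy's estimate turns the locally uniform bound on the integrand into a bound on its
  derivative, hence on its difference quotients, and dominated convergence applies to these.\<close>

lemma holomorphic_on_lebesgue_integral:
  fixes f :: "complex \<Rightarrow> 'a \<Rightarrow> complex"
  assumes "open S"
    and meas: "\<And>z. z \<in> S \<Longrightarrow> f z \<in> borel_measurable M"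
    and hol: "\<And>x. x \<in> space M \<Longrightarrow> (\<lambda>z. f z x) holomorphic_on S"
    and bound: "\<And>z0. z0 \<in> S \<Longrightarrow> \<exists>r>0. \<exists>g. integrable M g \<and>
      (\<forall>z\<in>ball z0 r \<inter> S. \<forall>x\<in>space M. norm (f z x) \<le> g x)"
  shows "(\<lambda>z. \<integral>x. f z x \<partial>M) holomorphic_on S"
proof (rule holomorphic_onI)
  fix z0 assume z0: "z0 \<in> S"
  obtain r g where r: "r > 0" "integrable M g"
    and g: "\<And>z x. z \<in> ball z0 r \<inter> S \<Longrightarrow> x \<in> space M \<Longrightarrow> norm (f z x) \<le> g x"
    using bound[OF z0] by blast
  obtain \<epsilon> where \<epsilon>: "\<epsilon> > 0" "ball z0 \<epsilon> \<subseteq> ball z0 r \<inter> S"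
    using \<open>open S\<close> z0 r(1) by (metis IntI centre_in_ball open_Int open_ball open_contains_ball)
  \<comment> \<open>A third, so that discs of radius \<open>e\<close> around points of \<open>cball z0 e\<close> stay inside the domain.\<close>
  define e where "e = \<epsilon> / 3"
  have e: "e > 0" using \<epsilon> by (simp add: e_def)
  have sub: "cball z e \<subseteq> ball z0 r \<inter> S" if "z \<in> cball z0 e" for z
  proof -
    have "cball z e \<subseteq> ball z0 \<epsilon>"
    proof
      fix w assume "w \<in> cball z e"
      thus "w \<in> ball z0 \<epsilon>"
        using that e dist_triangle[of z0 w z] by (auto simp: e_def)
    qed
    thus ?thesis using \<epsilon> by blast
  qed
  have inS: "z \<in> S" if "z \<in> cball z0 e" for z
    using sub[OF that] e by auto
  have lip: "norm (f z x - f z0 x) \<le> g x / e * norm (z - z0)"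
    if z: "z \<in> cball z0 e" and x: "x \<in> space M" for z x
  proof (rule field_differentiable_bound[where S = "cball z0 e" and f' = "deriv (\<lambda>z. f z x)"])
    fix w assume w: "w \<in> cball z0 e"
    show "((\<lambda>z. f z x) has_field_derivative deriv (\<lambda>z. f z x) w) (at w within cball z0 e)"
      using hol[OF x] \<open>open S\<close> inS[OF w]
      by (meson has_field_derivative_at_within holomorphic_derivI)
    have h: "(\<lambda>z. f z x) holomorphic_on cball w e"
      using hol[OF x] sub[OF w] holomorphic_on_subset by blast
    have "norm ((deriv ^^ 1) (\<lambda>z. f z x) w) \<le> fact 1 * g x / e ^ 1"
    proof (rule Cauchy_inequality)
      show "(\<lambda>z. f z x) holomorphic_on ball w e"
        using h ball_subset_cball holomorphic_on_subset by blast
      show "continuous_on (cball w e) (\<lambda>z. f z x)"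
        using h holomorphic_on_imp_continuous_on by blast
      show "norm (f v x) \<le> g x" if "norm (w - v) = e" for v
        using that sub[OF w] x by (intro g) (auto simp: dist_norm subset_iff)
    qed (use e in auto)
    thus "norm (deriv (\<lambda>z. f z x) w) \<le> g x / e" by simp
  qed (use z e in auto)
  have int: "integrable M (f z)" if "z \<in> cball z0 e" for z
  proof (rule Bochner_Integration.integrable_bound[OF r(2)])
    have "z \<in> cball z e" using e by simp
    hence "z \<in> ball z0 r \<inter> S" using sub[OF that] by blast
    thus "f z \<in> borel_measurable M" "AE x in M. norm (f z x) \<le> norm (g x)"
      using meas g by (auto intro!: AE_I2 order_trans[OF g])
  qed
  let ?Q = "\<lambda>z x. (f z x - f z0 x) / (z - z0)"
  have lim: "((\<lambda>z. ?Q z x) \<longlongrightarrow> deriv (\<lambda>z. f z x) z0) (at z0)" if "x \<in> space M" for x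
    using holomorphic_derivI[OF hol[OF that] \<open>open S\<close> z0]
    by (simp add: has_field_derivative_iff)
  have "((\<lambda>z. ((\<integral>x. f z x \<partial>M) - (\<integral>x. f z0 x \<partial>M)) / (z - z0)) \<longlongrightarrow>
      (\<integral>x. deriv (\<lambda>z. f z x) z0 \<partial>M)) (at z0)"
    unfolding tendsto_at_iff_sequentially comp_def
  proof (intro allI impI)
    fix X :: "nat \<Rightarrow> complex"
    assume X: "\<forall>i. X i \<in> UNIV - {z0}" "X \<longlonglongrightarrow> z0"
    have "eventually (\<lambda>n. X n \<in> ball z0 e) sequentially"
      using X(2) e by (intro topological_tendstoD) auto
    then obtain N where N: "\<And>n. n \<ge> N \<Longrightarrow> X n \<in> ball z0 e"
      by (auto simp: eventually_sequentially)
    define Y where "Y n = X (n + N)" for n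
    have Y: "Y n \<in> cball z0 e" "Y n \<noteq> z0" for n
      using N[of "n + N"] X(1) by (auto simp: Y_def)
    have Ylim: "filterlim Y (at z0) sequentially"
      using LIMSEQ_ignore_initial_segment[OF X(2), of N] Y(2)
      unfolding filterlim_at Y_def by auto
    have qmeas: "(\<lambda>x. ?Q (Y n) x) \<in> borel_measurable M" for n
      using meas[OF z0] meas[OF inS[OF Y(1)[of n]]] by simp
    have qlim: "(\<lambda>n. ?Q (Y n) x) \<longlonglongrightarrow> deriv (\<lambda>z. f z x) z0" if "x \<in> space M" for x
      using filterlim_compose[OF lim[OF that] Ylim] .
    have "(\<lambda>n. \<integral>x. ?Q (Y n) x \<partial>M) \<longlonglongrightarrow> (\<integral>x. deriv (\<lambda>z. f z x) z0 \<partial>M)"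
    proof (rule integral_dominated_convergence[where w = "\<lambda>x. g x / e"])
      show "(\<lambda>x. deriv (\<lambda>z. f z x) z0) \<in> borel_measurable M"
        by (rule borel_measurable_LIMSEQ_metric[OF qmeas qlim])
      show "AE x in M. norm (?Q (Y n) x) \<le> g x / e" for n
        using lip[OF Y(1)[of n]] Y(2)[of n] by (auto simp: norm_divide divide_le_eq)
    qed (use qmeas qlim r in auto)
    also have "(\<lambda>n. \<integral>x. ?Q (Y n) x \<partial>M) =
        (\<lambda>n. ((\<integral>x. f (Y n) x \<partial>M) - (\<integral>x. f z0 x \<partial>M)) / (Y n - z0))"
      using Y e by (intro ext) (simp add: int Bochner_Integration.integral_diff)
    finally show "(\<lambda>n. ((\<integral>x. f (X n) x \<partial>M) - (\<integral>x. f z0 x \<partial>M)) / (X n - z0))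
        \<longlonglongrightarrow> (\<integral>x. deriv (\<lambda>z. f z x) z0 \<partial>M)"
      unfolding Y_def by (rule LIMSEQ_offset)
  qed
  hence "(\<lambda>z. \<integral>x. f z x \<partial>M) field_differentiable at z0"
    unfolding field_differentiable_def has_field_derivative_iff by blast
  thus "(\<lambda>z. \<integral>x. f z x \<partial>M) field_differentiable at z0 within S"
    by (rule field_differentiable_at_within)
qed

lemma integral_halfline_FTC:
  fixes F f :: "real \<Rightarrow> complex"
  assumes "\<And>x. x > 0 \<Longrightarrow> (F has_vector_derivative f x) (at x)"
    and "\<And>x. x > 0 \<Longrightarrow> isCont f x"
    and "set_integrable lborel {0<..} f"
    and "(F \<longlongrightarrow> A) (at_right 0)" and "(F \<longlongrightarrow> B) at_top"
  shows "(LINT x:{0<..}|lborel. f x) = B - A"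
proof -
  have "(LBINT x=0..\<infinity>. f x) = B - A"
  proof (rule interval_integral_FTC_integrable[where F = F])
    show "((F \<circ> real_of_ereal) \<longlongrightarrow> A) (at_right 0)"
      using assms(4) by (simp add: zero_ereal_def ereal_tendsto_simps)
    show "((F \<circ> real_of_ereal) \<longlongrightarrow> B) (at_left \<infinity>)"
      using assms(5) by (simp add: ereal_tendsto_simps)
    show "set_integrable lborel (einterval 0 \<infinity>) f"
      using assms(3) by (simp add: einterval_def greaterThan_def zero_ereal_def)
  qed (use assms in \<open>auto simp: zero_ereal_def\<close>)
  thus ?thesis by (simp add: interval_integral_to_infinity_eq zero_ereal_def)
qed

section \<open>Gamma and Beta integrals with complex parameters\<close>

lemma nn_integral_powr_exp:
  assumes "a > 0" "s > (0::real)"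
  shows "(\<integral>\<^sup>+t\<in>{0<..}. ennreal (t powr (a - 1) * exp (- (s * t))) \<partial>lborel) =
    ennreal (Gamma a * s powr (- a))"
proof -
  let ?f = "\<lambda>t::real. indicator {0<..} t * (t powr (a - 1) * exp (- t))"
  have "((\<lambda>t. if t \<in> {0..} then t powr (a - 1) / exp t else 0) has_integral Gamma a) UNIV"
    using Gamma_integral_real[OF assms(1)] by (subst has_integral_restrict_UNIV)
  also have "(\<lambda>t. if t \<in> {0..} then t powr (a - 1) / exp t else 0) = ?f"
    by (auto simp: fun_eq_iff exp_minus field_simps indicator_def)
  finally have "(?f has_integral Gamma a) UNIV" .
  hence 1: "(\<integral>\<^sup>+t. ennreal (?f t) \<partial>lborel) = ennreal (Gamma a)"
    by (intro nn_integral_has_integral_lborel) (auto simp: indicator_def)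
  have "(\<integral>\<^sup>+t. ennreal (?f t) \<partial>lborel) = ennreal s * (\<integral>\<^sup>+t. ennreal (?f (s * t)) \<partial>lborel)"
    using assms by (subst nn_integral_real_affine[where c = s and t = 0]) auto
  also have "(\<lambda>t. ennreal (?f (s * t))) = (\<lambda>t. ennreal (s powr (a - 1)) *
      (ennreal (t powr (a - 1) * exp (- (s * t))) * indicator {0<..} t))"
    using assms by (intro ext)
      (auto simp: indicator_def powr_mult zero_less_mult_iff ennreal_mult'[symmetric] mult_ac)
  also have "(\<integral>\<^sup>+t. ennreal (s powr (a - 1)) *
      (ennreal (t powr (a - 1) * exp (- (s * t))) * indicator {0<..} t) \<partial>lborel) =
      ennreal (s powr (a - 1)) * (\<integral>\<^sup>+t\<in>{0<..}. ennreal (t powr (a - 1) * exp (- (s * t))) \<partial>lborel)"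
    by (subst nn_integral_cmult) auto
  also have "ennreal s * (ennreal (s powr (a - 1)) * x) = ennreal (s powr a) * x" for x
    using assms by (simp add: mult.assoc[symmetric] ennreal_mult'[symmetric] powr_diff)
  finally have 2: "ennreal (s powr a) * (\<integral>\<^sup>+t\<in>{0<..}. ennreal (t powr (a - 1) * exp (- (s * t))) \<partial>lborel)
     = ennreal (Gamma a)" using 1 by simp
  have "ennreal (s powr (-a)) * (ennreal (s powr a) * (\<integral>\<^sup>+t\<in>{0<..}. ennreal (t powr (a - 1) * exp (- (s * t))) \<partial>lborel))
     = ennreal (Gamma a * s powr (-a))"
    unfolding 2 by (subst mult.commute) (simp add: ennreal_mult'')
  thus ?thesis
    using assms by (simp add: mult.assoc[symmetric] ennreal_mult'[symmetric] powr_minus)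
qed

lemma integral_powr_exp:
  assumes "a > 0" "s > (0::real)"
  shows "set_integrable lborel {0<..} (\<lambda>t. t powr (a - 1) * exp (- (s * t)))"
    and "(LINT t:{0<..}|lborel. t powr (a - 1) * exp (- (s * t))) = Gamma a * s powr (- a)"
proof -
  have "(\<integral>\<^sup>+t. ennreal (indicator {0<..} t *\<^sub>R (t powr (a - 1) * exp (- (s * t)))) \<partial>lborel) =
      ennreal (Gamma a * s powr (- a))"
    by (subst nn_integral_powr_exp[OF assms, symmetric], rule nn_integral_cong)
       (auto simp: indicator_def)
  hence "integrable lborel (\<lambda>t. indicator {0<..} t *\<^sub>R (t powr (a - 1) * exp (- (s * t)))) \<and>
      (\<integral>t. indicator {0<..} t *\<^sub>R (t powr (a - 1) * exp (- (s * t))) \<partial>lborel) = Gamma a * s powr (- a)"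
    using assms by (subst (asm) nn_integral_eq_integrable) (auto simp: Gamma_real_pos less_imp_le)
  thus "set_integrable lborel {0<..} (\<lambda>t. t powr (a - 1) * exp (- (s * t)))"
    "(LINT t:{0<..}|lborel. t powr (a - 1) * exp (- (s * t))) = Gamma a * s powr (- a)"
    by (auto simp: set_integrable_def set_lebesgue_integral_def)
qed

text \<open>Writing \<open>1 / (1 + t u)\<close> as the integral of \<open>exp (- (1 + t u) s)\<close> over \<open>s > 0\<close> and exchanging the
  order of integration leaves two Gamma integrals.  Everything is nonnegative, so the exchange
  also proves integrability.\<close>

lemma integral_powr_div:
  assumes "0 < a" "a < 1" "u > (0::real)"
  shows "set_integrable lborel {0<..} (\<lambda>t. t powr (a - 1) / (1 + t * u))"
    and "(LINT t:{0<..}|lborel. t powr (a - 1) / (1 + t * u)) = Gamma a * Gamma (1 - a) * u powr (- a)"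
proof -
  let ?f = "\<lambda>s t. ennreal (indicator {0<..} s * indicator {0<..} t * (t powr (a - 1) * exp (- ((1 + t * u) * s))))"
  have "(\<integral>\<^sup>+t. ennreal (indicator {0<..} t *\<^sub>R (t powr (a - 1) / (1 + t * u))) \<partial>lborel) =
      (\<integral>\<^sup>+t. \<integral>\<^sup>+s. ?f s t \<partial>lborel \<partial>lborel)"
  proof (rule nn_integral_cong)
    fix t :: real
    show "ennreal (indicator {0<..} t *\<^sub>R (t powr (a - 1) / (1 + t * u))) = (\<integral>\<^sup>+s. ?f s t \<partial>lborel)"
    proof (cases "t > 0")
      case True
      hence pos: "1 + t * u > 0" using assms by (simp add: add_pos_pos)
      have "(\<integral>\<^sup>+s. ?f s t \<partial>lborel) =
          (\<integral>\<^sup>+s. ennreal (t powr (a - 1)) * (ennreal (s powr (1 - 1) * exp (- ((1 + t * u) * s))) * indicator {0<..} s) \<partial>lborel)"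
        using True by (intro nn_integral_cong) (auto simp: indicator_def ennreal_mult'')
      also have "\<dots> = ennreal (t powr (a - 1)) * ennreal (Gamma 1 * (1 + t * u) powr (- 1))"
        by (subst nn_integral_cmult, simp, subst nn_integral_powr_exp) (use pos in auto)
      also have "\<dots> = ennreal (t powr (a - 1) / (1 + t * u))"
        using pos by (simp add: ennreal_mult''[symmetric] powr_minus divide_inverse)
      finally show ?thesis using True by simp
    qed auto
  qed
  also have "\<dots> = (\<integral>\<^sup>+s. \<integral>\<^sup>+t. ?f s t \<partial>lborel \<partial>lborel)"
    by (rule lborel_pair.Fubini') measurable
  also have "\<dots> = (\<integral>\<^sup>+s. ennreal (Gamma a * u powr (- a)) * (ennreal (s powr ((1 - a) - 1) * exp (- (1 * s))) * indicator {0<..} s) \<partial>lborel)"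
  proof (rule nn_integral_cong)
    fix s :: real
    show "(\<integral>\<^sup>+t. ?f s t \<partial>lborel) = ennreal (Gamma a * u powr (- a)) * (ennreal (s powr ((1 - a) - 1) * exp (- (1 * s))) * indicator {0<..} s)"
    proof (cases "s > 0")
      case True
      have "(\<integral>\<^sup>+t. ?f s t \<partial>lborel) =
          (\<integral>\<^sup>+t. ennreal (exp (- s)) * (ennreal (t powr (a - 1) * exp (- ((s * u) * t))) * indicator {0<..} t) \<partial>lborel)"
        using True by (intro nn_integral_cong)
          (auto simp: indicator_def ennreal_mult'[symmetric] exp_add[symmetric] algebra_simps)
      also have "\<dots> = ennreal (exp (- s)) * ennreal (Gamma a * (s * u) powr (- a))"
        by (subst nn_integral_cmult, simp, subst nn_integral_powr_exp) (use assms True in auto)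
      also have "\<dots> = ennreal (Gamma a * u powr (- a) * (s powr ((1 - a) - 1) * exp (- (1 * s))))"
        using assms True by (simp add: ennreal_mult'[symmetric] powr_mult mult_ac)
      finally show ?thesis
        using True by (simp add: ennreal_mult'')
    qed auto
  qed
  also have "\<dots> = ennreal (Gamma a * u powr (- a)) * ennreal (Gamma (1 - a) * 1 powr (- (1 - a)))"
    by (subst nn_integral_cmult, simp, subst nn_integral_powr_exp) (use assms in auto)
  also have "\<dots> = ennreal (Gamma a * Gamma (1 - a) * u powr (- a))"
    using assms by (simp add: ennreal_mult''[symmetric] Gamma_real_pos less_imp_le mult_ac)
  finally have "integrable lborel (\<lambda>t. indicator {0<..} t *\<^sub>R (t powr (a - 1) / (1 + t * u))) \<and>
      (\<integral>t. indicator {0<..} t *\<^sub>R (t powr (a - 1) / (1 + t * u)) \<partial>lborel) = Gamma a * Gamma (1 - a) * u powr (- a)"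
    using assms by (subst (asm) nn_integral_eq_integrable)
      (auto simp: Gamma_real_pos less_imp_le indicator_def intro!: AE_I2 divide_nonneg_nonneg add_nonneg_nonneg)
  thus "set_integrable lborel {0<..} (\<lambda>t. t powr (a - 1) / (1 + t * u))"
    "(LINT t:{0<..}|lborel. t powr (a - 1) / (1 + t * u)) = Gamma a * Gamma (1 - a) * u powr (- a)"
    by (auto simp: set_integrable_def set_lebesgue_integral_def)
qed

text \<open>The form of the identity theorem that carries the real Gamma and Beta integrals over to complex
  parameters.\<close>

lemma holomorphic_eq_if_eq_on_pos_reals:
  assumes "f holomorphic_on S" "g holomorphic_on S"
    and "\<And>x. x > 0 \<Longrightarrow> f (of_real x) = g (complex_of_real x)"
    and "open S" "connected S" "of_real ` {0<..} \<subseteq> S" "z \<in> S"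
  shows "f z = g z"
proof -
  have "(1::complex) islimpt of_real ` {0<..}"
    unfolding islimpt_sequential
  proof (intro exI[of _ "\<lambda>n. complex_of_real (1 + inverse (real (Suc n)))"] conjI allI)
    have "(\<lambda>n. complex_of_real (1 + inverse (real (Suc n)))) \<longlonglongrightarrow> of_real (1 + 0)"
      by (intro tendsto_intros LIMSEQ_inverse_real_of_nat)
    thus "(\<lambda>n. complex_of_real (1 + inverse (real (Suc n)))) \<longlonglongrightarrow> 1" by simp
    show "complex_of_real (1 + inverse (real (Suc n))) \<in> of_real ` {0<..} - {1}" for n
    proof -
      have "inverse (real (Suc n)) > 0" by simp
      hence "1 + inverse (real (Suc n)) > 0" "1 + inverse (real (Suc n)) \<noteq> 1" by linarith+
      thus ?thesis by (auto simp del: of_nat_Suc of_real_add simp: of_real_eq_1_iff)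
    qed
  qed
  hence "f z - g z = 0"
    using assms by (intro analytic_continuation[of "\<lambda>z. f z - g z" S "of_real ` {0<..}" 1 z])
      (auto intro!: holomorphic_intros)
  thus ?thesis by simp
qed

lemma integral_powr_exp_complex:
  assumes "a > 0" "Re X > 0"
  shows "set_integrable lborel {0<..} (\<lambda>t. of_real (t powr (a - 1)) * exp (- (of_real t * X)))"
    and "(LINT t:{0<..}|lborel. of_real (t powr (a - 1)) * exp (- (of_real t * X))) =
      of_real (Gamma a) * X powr (- of_real a)"
proof -
  show int: "set_integrable lborel {0<..} (\<lambda>t. of_real (t powr (a - 1)) * exp (- (of_real t * X)))"
    by (rule set_integrable_bound[OF integral_powr_exp(1)[OF assms]])
       (auto simp: set_borel_measurable_def norm_mult mult.commute)
  let ?f = "\<lambda>X t. indicator {0<..} t *\<^sub>R (of_real (t powr (a - 1)) * exp (- (of_real t * X))) :: complex"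
  let ?S = "{X. Re X > 0}"
  have "(\<lambda>X. \<integral>t. ?f X t \<partial>lborel) holomorphic_on ?S"
  proof (rule holomorphic_on_lebesgue_integral)
    fix X0 assume "X0 \<in> ?S"
    define r where "r = Re X0 / 2"
    have r: "r > 0" using \<open>X0 \<in> ?S\<close> by (simp add: r_def)
    have "Re X \<ge> r" if "X \<in> ball X0 r" for X
      using that abs_Re_le_cmod[of "X0 - X"] by (auto simp: dist_norm r_def)
    hence "norm (?f X t) \<le> indicator {0<..} t *\<^sub>R (t powr (a - 1) * exp (- (r * t)))" if "X \<in> ball X0 r" for X t
      using that by (auto simp: indicator_def norm_mult mult.commute intro!: mult_left_mono)
    thus "\<exists>r>0. \<exists>g. integrable lborel g \<and> (\<forall>X\<in>ball X0 r \<inter> ?S. \<forall>t\<in>space lborel. norm (?f X t) \<le> g t)"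
      using integral_powr_exp(1)[OF assms(1) r] r unfolding set_integrable_def by blast
  qed (auto simp: open_halfspace_Re_gt intro!: holomorphic_intros)
  moreover have "(\<lambda>X. of_real (Gamma a) * X powr (- of_real a)) holomorphic_on ?S"
    by (intro holomorphic_intros) (auto simp: complex_nonpos_Reals_iff)
  moreover have "(\<integral>t. ?f (of_real x) t \<partial>lborel) = of_real (Gamma a) * of_real x powr (- of_real a)" if "x > 0" for x
  proof -
    have "(\<integral>t. ?f (of_real x) t \<partial>lborel) =
        (LINT t:{0<..}|lborel. complex_of_real (t powr (a - 1) * exp (- (x * t))))"
      unfolding set_lebesgue_integral_def
      by (intro Bochner_Integration.integral_cong) (auto simp: exp_of_real[symmetric] mult.commute)
    also have "\<dots> = of_real (Gamma a * x powr (- a))"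
      unfolding set_integral_complex_of_real integral_powr_exp(2)[OF assms(1) that] ..
    finally show ?thesis
      using that by (simp add: powr_of_real[symmetric])
  qed
  ultimately have "(\<lambda>X. \<integral>t. ?f X t \<partial>lborel) X = (\<lambda>X. of_real (Gamma a) * X powr (- of_real a)) X"
    by (rule holomorphic_eq_if_eq_on_pos_reals[of "\<lambda>X. \<integral>t. ?f X t \<partial>lborel" ?S
          "\<lambda>X. of_real (Gamma a) * X powr (- of_real a)" X])
       (use assms in \<open>auto simp: open_halfspace_Re_gt convex_halfspace_Re_gt convex_connected\<close>)
  thus "(LINT t:{0<..}|lborel. of_real (t powr (a - 1)) * exp (- (of_real t * X))) =
      of_real (Gamma a) * X powr (- of_real a)"
    by (simp add: set_lebesgue_integral_def)
qed

text \<open>Up to the factor \<open>1 + t\<close>, the number \<open>1 + t u\<close> is a point of the segment from \<open>1\<close> to \<open>u\<close>.  This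
  segment avoids \<open>0\<close> when \<open>u\<close> lies in the slit plane, so it keeps a positive distance from \<open>0\<close>,
  half of which survives a small perturbation of \<open>u\<close>.\<close>

lemma slit_plane_denominator_bound:
  fixes u :: complex
  assumes "u \<notin> \<real>\<^sub>\<le>\<^sub>0"
  shows "\<exists>\<delta>>0. \<forall>v\<in>ball u \<delta>. \<forall>t\<ge>0. norm (1 + of_real t * v) \<ge> \<delta> * (1 + t)"
proof -
  define d where "d = infdist 0 (closed_segment 1 u)"
  have "(0::complex) \<notin> closed_segment 1 u"
  proof
    assume "0 \<in> closed_segment 1 u"
    then obtain s where s: "0 \<le> s" "s \<le> 1" "0 = (1 - s) *\<^sub>R 1 + s *\<^sub>R u"
      by (auto simp: in_segment)
    hence "s \<noteq> 0" by auto
    hence "u = of_real (- (1 - s) / s)"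
      using s(3) by (auto simp: scaleR_conv_of_real field_simps)
    moreover have "- (1 - s) / s \<le> 0" using s \<open>s \<noteq> 0\<close> by (auto simp: divide_simps)
    ultimately show False using assms by (metis nonpos_Reals_of_real_iff)
  qed
  hence d: "d > 0"
    unfolding d_def by (subst infdist_pos_not_in_closed) auto
  have main: "norm (1 + of_real t * u) \<ge> d * (1 + t)" if "t \<ge> 0" for t
  proof -
    define s where "s = t / (1 + t)"
    have s: "0 \<le> s" "s \<le> 1" "1 - s = inverse (1 + t)" "s = inverse (1 + t) * t"
      using that by (auto simp: s_def field_simps)
    have "inverse (1 + t) *\<^sub>R (1 + of_real t * u) = (1 - s) *\<^sub>R 1 + s *\<^sub>R u"
      unfolding s(3) by (subst s(4)) (simp add: scaleR_conv_of_real distrib_left mult.assoc)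
    hence "inverse (1 + t) *\<^sub>R (1 + of_real t * u) \<in> closed_segment 1 u"
      unfolding in_segment using s(1,2) by (intro exI[of _ s] conjI)
    hence "d \<le> dist 0 (inverse (1 + t) *\<^sub>R (1 + of_real t * u))"
      unfolding d_def by (rule infdist_le)
    also have "\<dots> = norm (1 + of_real t * u) / (1 + t)"
      using that by (simp add: divide_inverse mult.commute)
    finally show ?thesis using that by (simp add: pos_le_divide_eq)
  qed
  have "norm (1 + of_real t * v) \<ge> d / 2 * (1 + t)" if "v \<in> ball u (d / 2)" "t \<ge> 0" for v t
  proof -
    have "norm (of_real t * (u - v)) \<le> t * (d / 2)"
      using that mult_left_mono[of "norm (u - v)" "d / 2" t] by (simp add: norm_mult dist_norm)
    moreover have "norm (1 + of_real t * u) \<le> norm (1 + of_real t * v) + norm (of_real t * (u - v))"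
      using norm_triangle_ineq[of "1 + of_real t * v" "of_real t * (u - v)"]
      by (simp add: right_diff_distrib)
    ultimately show ?thesis using main[OF that(2)] d by (simp add: algebra_simps)
  qed
  thus ?thesis using d by (intro exI[of _ "d / 2"]) auto
qed

lemma holomorphic_powr_div_integral:
  fixes v :: complex
  assumes "0 < a" "a < 1" and [measurable]: "\<phi> \<in> borel_measurable borel"
    and C: "\<And>t. t > 0 \<Longrightarrow> norm (\<phi> t :: complex) \<le> C * t powr (a - 1)"
  shows "(\<lambda>v. LINT t:{0<..}|lborel. \<phi> t / (1 + of_real t * v)) holomorphic_on (- \<real>\<^sub>\<le>\<^sub>0)"
    and "v \<notin> \<real>\<^sub>\<le>\<^sub>0 \<Longrightarrow> set_integrable lborel {0<..} (\<lambda>t. \<phi> t / (1 + of_real t * v))"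
proof -
  let ?f = "\<lambda>v t. indicator {0<..} t *\<^sub>R (\<phi> t / (1 + of_real t * v))"
  have *: "\<exists>r>0. \<exists>g. integrable lborel g \<and> (\<forall>v\<in>ball v0 r. \<forall>t. norm (?f v t) \<le> g t)"
    if v0: "v0 \<notin> \<real>\<^sub>\<le>\<^sub>0" for v0 :: complex
  proof -
    obtain \<delta> where \<delta>: "\<delta> > 0" "\<And>v t. v \<in> ball v0 \<delta> \<Longrightarrow> t \<ge> 0 \<Longrightarrow> norm (1 + of_real t * v) \<ge> \<delta> * (1 + t)"
      using slit_plane_denominator_bound[OF v0] by blast
    let ?g = "\<lambda>t. C / \<delta> * (indicator {0<..} t *\<^sub>R (t powr (a - 1) / (1 + t * 1)))"
    have "norm (?f v t) \<le> ?g t" if "v \<in> ball v0 \<delta>" for v t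
    proof (cases "t > 0")
      case True
      have pos: "\<delta> * (1 + t) > 0" using True \<delta> by simp
      have "norm (\<phi> t / (1 + of_real t * v)) \<le> (C * t powr (a - 1)) / (\<delta> * (1 + t))"
        unfolding norm_divide
        using C[OF True] \<delta>(2)[OF that, of t] True pos
        by (intro frac_le) (auto intro: order_trans[OF norm_ge_zero])
      thus ?thesis using True by simp
    qed auto
    moreover have "integrable lborel ?g"
      using integral_powr_div(1)[OF assms(1,2), of 1]
      unfolding set_integrable_def by (intro integrable_mult_right) auto
    ultimately show ?thesis using \<delta>(1) by blast
  qed
  show "(\<lambda>v. LINT t:{0<..}|lborel. \<phi> t / (1 + of_real t * v)) holomorphic_on (- \<real>\<^sub>\<le>\<^sub>0)"
    unfolding set_lebesgue_integral_def
  proof (rule holomorphic_on_lebesgue_integral)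
    show "(\<lambda>v. ?f v t) holomorphic_on - \<real>\<^sub>\<le>\<^sub>0" for t
    proof (cases "t > 0")
      case True
      have "1 + of_real t * v \<noteq> 0" if "v \<notin> \<real>\<^sub>\<le>\<^sub>0" for v :: complex
      proof
        assume "1 + of_real t * v = 0"
        hence "of_real t * v = of_real t * of_real (- 1 / t)" using True by (simp add: add_eq_0_iff)
        hence "v = of_real (- 1 / t)" using True by (subst (asm) mult_cancel_left) simp
        moreover have "- 1 / t \<le> 0" using True by simp
        ultimately show False using that by (metis nonpos_Reals_of_real_iff)
      qed
      thus ?thesis by (auto intro!: holomorphic_intros)
    qed auto
  next
    fix v0 :: complex assume "v0 \<in> - \<real>\<^sub>\<le>\<^sub>0"
    thus "\<exists>r>0. \<exists>g. integrable lborel g \<and> (\<forall>v\<in>ball v0 r \<inter> - \<real>\<^sub>\<le>\<^sub>0. \<forall>t\<in>space lborel. norm (?f v t) \<le> g t)"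
      using *[of v0] by blast
  qed (auto simp: closed_nonpos_Reals_complex open_Compl)
  show "set_integrable lborel {0<..} (\<lambda>t. \<phi> t / (1 + of_real t * v))" if v: "v \<notin> \<real>\<^sub>\<le>\<^sub>0"
  proof -
    obtain r g where rg: "r > 0" "integrable lborel g" "\<And>w t. w \<in> ball v r \<Longrightarrow> norm (?f w t) \<le> g t"
      using *[OF v] by blast
    have "norm (?f v t) \<le> norm (g t)" for t
      using rg(3)[of v t] rg(1) by simp
    thus ?thesis unfolding set_integrable_def
      by (intro Bochner_Integration.integrable_bound[OF rg(2)]) auto
  qed
qed

lemma integral_powr_div_complex:
  fixes u :: complex
  assumes "0 < a" "a < 1" "u \<notin> \<real>\<^sub>\<le>\<^sub>0"
  shows "(LINT t:{0<..}|lborel. of_real (t powr (a - 1)) / (1 + of_real t * u)) =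
      of_real (Gamma a * Gamma (1 - a)) * u powr (- of_real a)"
proof (rule holomorphic_eq_if_eq_on_pos_reals[where S = "- \<real>\<^sub>\<le>\<^sub>0" and z = u])
  show "(\<lambda>u. LINT t:{0<..}|lborel. of_real (t powr (a - 1)) / (1 + of_real t * u)) holomorphic_on (- \<real>\<^sub>\<le>\<^sub>0)"
    by (rule holomorphic_powr_div_integral(1)[OF assms(1,2), where C = 1]) auto
  show "(LINT t:{0<..}|lborel. of_real (t powr (a - 1)) / (1 + of_real t * of_real x)) =
      of_real (Gamma a * Gamma (1 - a)) * complex_of_real x powr (- of_real a)" if "x > 0" for x
  proof -
    have "(\<lambda>t. complex_of_real (t powr (a - 1)) / (1 + of_real t * of_real x)) =
        (\<lambda>t. complex_of_real (t powr (a - 1) / (1 + t * x)))"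
      by simp
    thus ?thesis
      using integral_powr_div(2)[OF assms(1,2) that] that
      by (simp add: set_integral_complex_of_real powr_of_real[symmetric] del: of_real_divide)
  qed
  show "connected (- \<real>\<^sub>\<le>\<^sub>0 :: complex set)"
    using starlike_imp_connected[OF starlike_slotted_complex_plane_left[of 0]]
    by (simp add: nonpos_Reals_def image_def Bex_def Collect_conj_eq conj_commute)
qed (use assms in \<open>auto simp: closed_nonpos_Reals_complex open_Compl intro!: holomorphic_intros\<close>)

section \<open>The power defect as an integral of products of exponentials\<close>

text \<open>With \<open>a = 2 - \<beta>\<close> this is the dominating function for the integrals over \<open>\<tau>\<close> whose integrand
  contains a factor \<open>1 - exp (- \<tau> X)\<close>: it has their singularity at \<open>0\<close> and is integrable at
  infinity.\<close>

lemma set_integrable_powr_div: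
  assumes "0 < a" "a < (1::real)"
  shows "set_integrable lborel {0<..} (\<lambda>t::real. t powr (a - 1) / (1 + t))"
  using integral_powr_div(1)[OF assms, of 1] by simp

lemma norm_one_minus_exp_le:
  fixes X :: complex
  assumes "Re X \<ge> 0"
  shows "norm (1 - exp (- X)) \<le> norm X"
proof -
  have "norm (exp (- X) - exp (- 0)) \<le> 1 * norm (X - 0)"
  proof (rule field_differentiable_bound[where S = "{z. Re z \<ge> 0}" and f' = "\<lambda>z. - exp (- z)"])
    show "((\<lambda>z. exp (- z)) has_field_derivative - exp (- z)) (at z within {z. Re z \<ge> 0})" for z :: complex
      by (auto intro!: derivative_eq_intros)
  qed (use assms in \<open>auto simp: convex_halfspace_Re_ge\<close>)
  thus ?thesis by (simp add: norm_minus_commute)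
qed

text \<open>The factor \<open>t / (1 + t)\<close> records both bounds at once: the linear one near \<open>0\<close> and the constant
  one at infinity.\<close>

lemma norm_one_minus_exp_scaled_le:
  fixes X :: complex
  assumes "Re X \<ge> 0" "t > 0"
  shows "norm (1 - exp (- (of_real t * X))) \<le> t / (1 + t) * (2 + norm X)"
proof -
  have "norm (1 - exp (- (of_real t * X))) \<le> 1 + 1"
    using assms by (intro order_trans[OF norm_triangle_ineq4] add_mono) auto
  hence "t * norm (1 - exp (- (of_real t * X))) \<le> t * 2"
    using assms by (intro mult_left_mono) auto
  moreover have "norm (1 - exp (- (of_real t * X))) \<le> t * norm X"
    using norm_one_minus_exp_le[of "of_real t * X"] assms by (simp add: norm_mult)
  ultimately have "(1 + t) * norm (1 - exp (- (of_real t * X))) \<le> t * (2 + norm X)"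
    by (simp add: distrib_left distrib_right)
  thus ?thesis using assms by (simp add: field_simps)
qed

text \<open>Integration by parts without boundary terms.\<close>

lemma integral_derivative_eq_0:
  fixes F f :: "real \<Rightarrow> complex"
  assumes "\<And>x. x > 0 \<Longrightarrow> (F has_vector_derivative f x) (at x)"
    and "\<And>x. x > 0 \<Longrightarrow> isCont f x"
    and "set_integrable lborel {0<..} f"
    and "p > 0" "q > 0"
    and b0: "\<And>x. x > 0 \<Longrightarrow> norm (F x) \<le> C * x powr p"
    and b1: "\<And>x. x > 0 \<Longrightarrow> norm (F x) \<le> D * x powr (- q)"
  shows "(LINT x:{0<..}|lborel. f x) = 0"
proof -
  have "(F \<longlongrightarrow> 0) (at_right 0)"
  proof (rule Lim_null_comparison)
    show "\<forall>\<^sub>F x in at_right 0. norm (F x) \<le> C * x powr p"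
      using b0 by (auto simp: eventually_at_right_field intro: exI[of _ 1])
    have "((\<lambda>x::real. x powr p) \<longlongrightarrow> 0) (at_right 0)"
      using \<open>p > 0\<close>
      by (intro tendsto_zero_powrI[where b = p] tendsto_intros) (auto simp: eventually_at_right_field intro: exI[of _ 1])
    thus "((\<lambda>x. C * x powr p) \<longlongrightarrow> 0) (at_right 0)"
      using tendsto_mult_right_zero by blast
  qed
  moreover have "(F \<longlongrightarrow> 0) at_top"
  proof (rule Lim_null_comparison)
    show "\<forall>\<^sub>F x in at_top. norm (F x) \<le> D * x powr (- q)"
      using b1 by (intro eventually_mono[OF eventually_gt_at_top[of 0]])
    have "((\<lambda>x::real. x powr (- q)) \<longlongrightarrow> 0) at_top"
      using \<open>q > 0\<close> by (intro tendsto_neg_powr filterlim_ident) auto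
    thus "((\<lambda>x. D * x powr (- q)) \<longlongrightarrow> 0) at_top"
      using tendsto_mult_right_zero by blast
  qed
  ultimately show ?thesis
    using integral_halfline_FTC[OF assms(1,2,3)] by simp
qed

lemma has_vector_derivative_of_real_powr:
  "x > 0 \<Longrightarrow> ((\<lambda>t. complex_of_real (t powr b)) has_vector_derivative of_real (b * x powr (b - 1))) (at x)"
  by (intro has_vector_derivative_of_real)
     (auto simp: has_real_derivative_iff_has_vector_derivative[symmetric] intro!: derivative_eq_intros)

lemma has_vector_derivative_exp_scaled:
  fixes X :: complex
  shows "((\<lambda>t. exp (- (of_real t * X))) has_vector_derivative - (X * exp (- (of_real x * X)))) (at x)"
  by (rule has_vector_derivative_real_field) (auto intro!: derivative_eq_intros)

text \<open>The integrals in this and the next lemmas represent the second derivative, the first derivative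
  and the value of \<open>(X + Y)\<^sup>\<beta> - X\<^sup>\<beta> - Y\<^sup>\<beta>\<close>.  The first is a Gamma integral; each of the others
  follows from its predecessor by integrating by parts, which lowers the exponent of \<open>t\<close> by one,
  and the factors \<open>1 - exp (- t Y)\<close> keep the integrals convergent at \<open>0\<close>.\<close>

lemma power_kernel_0:
  fixes \<beta> :: real and X :: complex
  assumes \<beta>: "1 < \<beta>" "\<beta> < 2" and X: "Re X > 0"
  shows "set_integrable lborel {0<..} (\<lambda>t. of_real (t powr (1 - \<beta>)) * exp (- (of_real t * X)))"
    and "(LINT t:{0<..}|lborel. of_real (t powr (1 - \<beta>)) * exp (- (of_real t * X))) =
      of_real (Gamma (2 - \<beta>)) * X powr (of_real \<beta> - 2)"
  using integral_powr_exp_complex[of "2 - \<beta>" X] \<beta> X by simp_all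

context
  fixes \<beta> :: real and X Y :: complex
  assumes \<beta>: "1 < \<beta>" "\<beta> < 2" and X: "Re X > 0" and Y: "Re Y > 0"
begin

lemma power_kernel_1_integrable:
  "set_integrable lborel {0<..}
     (\<lambda>t. of_real (t powr (- \<beta>)) * (exp (- (of_real t * X)) * (1 - exp (- (of_real t * Y)))))"
proof (rule set_integrable_bound)
  show "set_integrable lborel {0<..} (\<lambda>t. (2 + norm Y) * (t powr ((2 - \<beta>) - 1) / (1 + t)))"
    using set_integrable_powr_div[of "2 - \<beta>"] \<beta> by (intro set_integrable_mult_right) auto
  have "norm (of_real (t powr (- \<beta>)) * (exp (- (of_real t * X)) * (1 - exp (- (of_real t * Y)))))
       \<le> (2 + norm Y) * (t powr ((2 - \<beta>) - 1) / (1 + t))" if "t > 0" for t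
  proof -
    have "norm (of_real (t powr (- \<beta>)) * (exp (- (of_real t * X)) * (1 - exp (- (of_real t * Y)))))
        \<le> t powr (- \<beta>) * (1 * (t / (1 + t) * (2 + norm Y)))"
      unfolding norm_mult using that X Y
      by (intro mult_mono norm_one_minus_exp_scaled_le) auto
    also have "\<dots> = (2 + norm Y) * (t powr ((2 - \<beta>) - 1) / (1 + t))"
      using that by (simp add: powr_diff powr_minus field_simps)
    finally show ?thesis .
  qed
  thus "AE t in lborel. t \<in> {0<..} \<longrightarrow> norm (of_real (t powr (- \<beta>)) * (exp (- (of_real t * X)) * (1 - exp (- (of_real t * Y)))))
       \<le> norm ((2 + norm Y) * (t powr ((2 - \<beta>) - 1) / (1 + t)))"
    by (auto intro: order_trans[OF _ abs_ge_self] simp del: abs_mult)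
qed (auto simp: set_borel_measurable_def)

lemma power_kernel_2_integrable:
  "set_integrable lborel {0<..}
     (\<lambda>t. of_real (t powr (- \<beta> - 1)) * ((1 - exp (- (of_real t * X))) * (1 - exp (- (of_real t * Y)))))"
proof (rule set_integrable_bound)
  let ?C = "(2 + norm X) * (2 + norm Y)"
  show "set_integrable lborel {0<..} (\<lambda>t. ?C * (t powr ((2 - \<beta>) - 1) / (1 + t)))"
    using set_integrable_powr_div[of "2 - \<beta>"] \<beta> by (intro set_integrable_mult_right) auto
  have "norm (of_real (t powr (- \<beta> - 1)) * ((1 - exp (- (of_real t * X))) * (1 - exp (- (of_real t * Y)))))
       \<le> ?C * (t powr ((2 - \<beta>) - 1) / (1 + t))" if "t > 0" for t
  proof -
    have "norm (of_real (t powr (- \<beta> - 1)) * ((1 - exp (- (of_real t * X))) * (1 - exp (- (of_real t * Y)))))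
        \<le> t powr (- \<beta> - 1) * ((t / (1 + t) * (2 + norm X)) * (t / 1 * (2 + norm Y)))"
      unfolding norm_mult using that X Y
      by (intro mult_mono norm_one_minus_exp_scaled_le
          order_trans[OF norm_one_minus_exp_scaled_le[of Y]] divide_left_mono) auto
    also have "\<dots> = ?C * (t powr ((2 - \<beta>) - 1) / (1 + t))"
    proof -
      have *: "t powr (- \<beta> - 1) * t\<^sup>2 = t powr ((2 - \<beta>) - 1)"
        using that by (simp add: powr_add[symmetric] flip: powr_numeral)
      show ?thesis unfolding *[symmetric] by (simp add: power2_eq_square)
    qed
    finally show ?thesis .
  qed
  thus "AE t in lborel. t \<in> {0<..} \<longrightarrow> norm (of_real (t powr (- \<beta> - 1)) * ((1 - exp (- (of_real t * X))) * (1 - exp (- (of_real t * Y)))))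
       \<le> norm (?C * (t powr ((2 - \<beta>) - 1) / (1 + t)))"
    by (auto intro: order_trans[OF _ abs_ge_self] simp del: abs_mult)
qed (auto simp: set_borel_measurable_def)

end

lemma power_kernel_1:
  fixes \<beta> :: real and X Y :: complex
  assumes \<beta>: "1 < \<beta>" "\<beta> < 2" and X: "Re X > 0" and Y: "Re Y > 0"
  shows "of_real (\<beta> - 1) * (LINT t:{0<..}|lborel. of_real (t powr (- \<beta>)) * (exp (- (of_real t * X)) * (1 - exp (- (of_real t * Y))))) =
     of_real (Gamma (2 - \<beta>)) * ((X + Y) powr (of_real \<beta> - 1) - X powr (of_real \<beta> - 1))"
proof -
  let ?E = "\<lambda>X t. exp (- (of_real t * X))"
  let ?f = "\<lambda>t. of_real (t powr (- \<beta>)) * (?E X t * (1 - ?E Y t))"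
  let ?g = "\<lambda>X t. of_real (t powr (1 - \<beta>)) * ?E X t"
  have XY: "Re (X + Y) > 0" using X Y by simp
  note int = power_kernel_1_integrable[OF \<beta> X Y] power_kernel_0(1)[OF \<beta> X] power_kernel_0(1)[OF \<beta> XY]
  have E: "?E (X + Y) t = ?E X t * ?E Y t" for t
    by (simp add: exp_add[symmetric] algebra_simps)
  have "(LINT t:{0<..}|lborel. of_real (1 - \<beta>) * ?f t + ((X + Y) * ?g (X + Y) t - X * ?g X t)) = 0"
  proof (rule integral_derivative_eq_0[where F = "\<lambda>t. of_real (t powr (1 - \<beta>)) * (?E X t * (1 - ?E Y t))"])
    show "((\<lambda>t. of_real (t powr (1 - \<beta>)) * (?E X t * (1 - ?E Y t))) has_vector_derivative
        of_real (1 - \<beta>) * ?f x + ((X + Y) * ?g (X + Y) x - X * ?g X x)) (at x)" if "x > 0" for x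
      unfolding E
      by (rule has_vector_derivative_eq_rhs, (rule derivative_intros has_vector_derivative_of_real_powr[OF that]
            has_vector_derivative_exp_scaled)+) (simp add: algebra_simps)
    show "isCont (\<lambda>t. of_real (1 - \<beta>) * ?f t + ((X + Y) * ?g (X + Y) t - X * ?g X t)) x" if "x > 0" for x
      using that by (intro continuous_intros) auto
    show "set_integrable lborel {0<..} (\<lambda>t. of_real (1 - \<beta>) * ?f t + ((X + Y) * ?g (X + Y) t - X * ?g X t))"
      by (intro set_integral_add(1) set_integral_diff(1) set_integrable_mult_right int impI)
    show "norm (of_real (x powr (1 - \<beta>)) * (?E X x * (1 - ?E Y x))) \<le> norm Y * x powr (2 - \<beta>)" if "x > 0" for x
    proof -
      have "norm (of_real (x powr (1 - \<beta>)) * (?E X x * (1 - ?E Y x))) \<le> x powr (1 - \<beta>) * (1 * norm (of_real x * Y))"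
        unfolding norm_mult[of "of_real (x powr (1 - \<beta>))"] norm_mult[of "?E X x"] using that X Y
        by (intro mult_mono norm_one_minus_exp_le) auto
      also have "\<dots> = norm Y * x powr (2 - \<beta>)"
        using that by (simp add: norm_mult powr_diff power2_eq_square)
      finally show ?thesis .
    qed
    show "norm (of_real (x powr (1 - \<beta>)) * (?E X x * (1 - ?E Y x))) \<le> 2 * x powr (- (\<beta> - 1))" if "x > 0" for x
    proof -
      have "norm (of_real (x powr (1 - \<beta>)) * (?E X x * (1 - ?E Y x))) \<le> x powr (1 - \<beta>) * (1 * (1 + 1))"
        unfolding norm_mult using that X Y
        by (intro mult_mono order_trans[OF norm_triangle_ineq4] add_mono) auto
      thus ?thesis by simp
    qed
  qed (use \<beta> in auto)
  hence eq: "of_real (1 - \<beta>) * (LINT t:{0<..}|lborel. ?f t) +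
      ((X + Y) * (LINT t:{0<..}|lborel. ?g (X + Y) t) - X * (LINT t:{0<..}|lborel. ?g X t)) = 0"
    by (subst (asm) set_integral_add(2), (intro set_integral_diff(1) set_integrable_mult_right int impI)+)
       (subst (asm) set_integral_diff(2), (intro set_integrable_mult_right int impI)+, simp)
  have pw: "Z * Z powr (of_real \<beta> - 2) = Z powr (of_real \<beta> - 1)" if "Re Z > 0" for Z
    using that powr_add[of Z 1 "of_real \<beta> - 2"] by (auto simp: algebra_simps)
  have solve: "of_real (\<beta> - 1) * I = D" if "of_real (1 - \<beta>) * I + D = 0" for I D :: complex
  proof -
    have "of_real (\<beta> - 1) * I = - (of_real (1 - \<beta>) * I)" by (simp add: left_diff_distrib)
    also have "\<dots> = D" using that by (simp only: add_eq_0_iff)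
    finally show ?thesis .
  qed
  have "of_real (\<beta> - 1) * (LINT t:{0<..}|lborel. ?f t) =
      (X + Y) * (LINT t:{0<..}|lborel. ?g (X + Y) t) - X * (LINT t:{0<..}|lborel. ?g X t)"
    by (rule solve[OF eq])
  also have "\<dots> = of_real (Gamma (2 - \<beta>)) *
      ((X + Y) * (X + Y) powr (of_real \<beta> - 2) - X * X powr (of_real \<beta> - 2))"
    unfolding power_kernel_0(2)[OF \<beta> X] power_kernel_0(2)[OF \<beta> XY]
    by (simp only: right_diff_distrib mult.left_commute)
  finally show ?thesis
    unfolding pw[OF X] pw[OF XY] .
qed

lemma power_kernel_2:
  fixes \<beta> :: real and X Y :: complex
  assumes \<beta>: "1 < \<beta>" "\<beta> < 2" and X: "Re X > 0" and Y: "Re Y > 0"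
  shows "of_real (\<beta> * (\<beta> - 1)) * (LINT t:{0<..}|lborel. of_real (t powr (- \<beta> - 1)) *
        ((1 - exp (- (of_real t * X))) * (1 - exp (- (of_real t * Y))))) =
     of_real (Gamma (2 - \<beta>)) * ((X + Y) powr of_real \<beta> - X powr of_real \<beta> - Y powr of_real \<beta>)"
proof -
  let ?E = "\<lambda>X t. exp (- (of_real t * X))"
  let ?f = "\<lambda>t. of_real (t powr (- \<beta> - 1)) * ((1 - ?E X t) * (1 - ?E Y t))"
  let ?g = "\<lambda>X Y t. of_real (t powr (- \<beta>)) * (?E X t * (1 - ?E Y t))"
  note int = power_kernel_2_integrable[OF \<beta> X Y] power_kernel_1_integrable[OF \<beta> X Y] power_kernel_1_integrable[OF \<beta> Y X]
  have "(LINT t:{0<..}|lborel. (X * ?g X Y t + Y * ?g Y X t) - of_real \<beta> * ?f t) = 0"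
  proof (rule integral_derivative_eq_0[where F = "\<lambda>t. of_real (t powr (- \<beta>)) * ((1 - ?E X t) * (1 - ?E Y t))"])
    show "((\<lambda>t. of_real (t powr (- \<beta>)) * ((1 - ?E X t) * (1 - ?E Y t))) has_vector_derivative
        (X * ?g X Y x + Y * ?g Y X x) - of_real \<beta> * ?f x) (at x)" if "x > 0" for x
      by (rule has_vector_derivative_eq_rhs, (rule derivative_intros has_vector_derivative_of_real_powr[OF that]
            has_vector_derivative_exp_scaled)+) (simp add: algebra_simps)
    show "isCont (\<lambda>t. (X * ?g X Y t + Y * ?g Y X t) - of_real \<beta> * ?f t) x" if "x > 0" for x
      using that by (intro continuous_intros) auto
    show "set_integrable lborel {0<..} (\<lambda>t. (X * ?g X Y t + Y * ?g Y X t) - of_real \<beta> * ?f t)"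
      by (intro set_integral_add(1) set_integral_diff(1) set_integrable_mult_right int impI)
    show "norm (of_real (x powr (- \<beta>)) * ((1 - ?E X x) * (1 - ?E Y x))) \<le> (norm X * norm Y) * x powr (2 - \<beta>)" if "x > 0" for x
    proof -
      have "norm (of_real (x powr (- \<beta>)) * ((1 - ?E X x) * (1 - ?E Y x))) \<le> x powr (- \<beta>) * (norm (of_real x * X) * norm (of_real x * Y))"
        unfolding norm_mult[of "of_real (x powr (- \<beta>))"] norm_mult[of "1 - ?E X x"] using that X Y
        by (intro mult_mono norm_one_minus_exp_le) auto
      also have "\<dots> = (norm X * norm Y) * x powr (2 - \<beta>)"
        using that by (simp add: norm_mult powr_diff powr_minus power2_eq_square field_simps)
      finally show ?thesis .
    qed
    show "norm (of_real (x powr (- \<beta>)) * ((1 - ?E X x) * (1 - ?E Y x))) \<le> 4 * x powr (- \<beta>)" if "x > 0" for x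
    proof -
      have "norm (of_real (x powr (- \<beta>)) * ((1 - ?E X x) * (1 - ?E Y x))) \<le> x powr (- \<beta>) * ((1 + 1) * (1 + 1))"
        unfolding norm_mult using that X Y
        by (intro mult_mono order_trans[OF norm_triangle_ineq4] add_mono) auto
      thus ?thesis by simp
    qed
  qed (use \<beta> in auto)
  hence eq: "of_real \<beta> * (LINT t:{0<..}|lborel. ?f t) =
      X * (LINT t:{0<..}|lborel. ?g X Y t) + Y * (LINT t:{0<..}|lborel. ?g Y X t)"
    by (subst (asm) set_integral_diff(2), (intro set_integral_add(1) set_integrable_mult_right int impI)+)
       (subst (asm) set_integral_add(2), (intro set_integrable_mult_right int impI)+, simp)
  have pw: "Z * Z powr (of_real \<beta> - 1) = Z powr of_real \<beta>" if "Re Z > 0" for Z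
    using that powr_add[of Z 1 "of_real \<beta> - 1"] by (auto simp: algebra_simps)
  have "of_real (\<beta> * (\<beta> - 1)) * (LINT t:{0<..}|lborel. ?f t) =
     of_real (\<beta> - 1) * (of_real \<beta> * (LINT t:{0<..}|lborel. ?f t))"
    by simp
  also have "\<dots> = X * (of_real (\<beta> - 1) * (LINT t:{0<..}|lborel. ?g X Y t)) + Y * (of_real (\<beta> - 1) * (LINT t:{0<..}|lborel. ?g Y X t))"
    unfolding eq by (simp only: distrib_left mult.left_commute)
  also have "\<dots> = of_real (Gamma (2 - \<beta>)) * ((X + Y) * (X + Y) powr (of_real \<beta> - 1) -
      X * X powr (of_real \<beta> - 1) - Y * Y powr (of_real \<beta> - 1))"
    unfolding power_kernel_1[OF \<beta> X Y] power_kernel_1[OF \<beta> Y X] by (simp add: algebra_simps)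
  also have "\<dots> = of_real (Gamma (2 - \<beta>)) * ((X + Y) powr of_real \<beta> - X powr of_real \<beta> - Y powr of_real \<beta>)"
    using X Y by (simp add: pw)
  finally show ?thesis .
qed

section \<open>The Stieltjes transform of the Marchenko--Pastur law\<close>

text \<open>This is the Stieltjes transform of the semicircle law.  Polynomial division by \<open>Z - cos \<theta>\<close>
  reduces the integrand to \<open>Z + cos \<theta>\<close> and a multiple of \<open>1 / (Z - cos \<theta>)\<close>, which is the Poisson
  kernel of \<open>\<omega>\<close>.\<close>

lemma has_integral_semicircle:
  fixes \<omega> Z :: complex
  assumes "\<omega> \<noteq> 0" "norm \<omega> < 1" and Z: "2 * Z = \<omega> + 1 / \<omega>"
  shows "((\<lambda>\<theta>. (sin (of_real \<theta>))\<^sup>2 / (Z - cos (of_real \<theta>))) has_integral of_real pi * \<omega>) {0..pi}"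
proof -
  let ?e = "\<lambda>x. exp (\<i> * x)" and ?e' = "\<lambda>x. exp (- (\<i> * x))"
  \<comment> \<open>With \<open>e = exp (\<i> \<theta>)\<close> the Poisson kernel is the sum of \<open>1\<close>, \<open>\<omega> e / (1 - \<omega> e)\<close> and \<open>(\<omega> / e) / (1 - \<omega> / e)\<close>; the fractions integrate to logarithms of numbers with positive real part, which cancel at both endpoints since \<open>e\<close> equals \<open>1 / e\<close> there.\<close>
  let ?A = "\<lambda>x. Z * x + sin x - (1 - \<omega>\<^sup>2) / (2 * \<omega>) * (x + \<i> * Ln (1 - \<omega> * ?e x) - \<i> * Ln (1 - \<omega> * ?e' x))"
  have w2: "1 - \<omega>\<^sup>2 \<noteq> 0"
  proof
    assume "1 - \<omega>\<^sup>2 = 0"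
    hence "(norm \<omega>)\<^sup>2 = 1" by (simp flip: norm_power)
    thus False using assms(2) abs_square_less_1[of "norm \<omega>"] by simp
  qed
  have less: "norm (\<omega> * exp (\<i> * of_real \<theta>)) < 1" "norm (\<omega> * exp (- (\<i> * of_real \<theta>))) < 1" for \<theta>
    using assms(2) by (simp_all add: norm_mult)
  have slit: "1 - v \<notin> \<real>\<^sub>\<le>\<^sub>0" "1 - v \<noteq> 0" if "norm v < 1" for v :: complex
    using that complex_Re_le_cmod[of v] by (auto simp: complex_nonpos_Reals_iff)
  have Zval: "Z = (\<omega> + 1 / \<omega>) / 2" using Z[symmetric] by simp
  have deriv: "(?A has_field_derivative (sin (of_real \<theta>))\<^sup>2 / (Z - cos (of_real \<theta>))) (at (of_real \<theta>))" for \<theta> :: real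
  proof -
    let ?x = "complex_of_real \<theta>"
    define E F where "E = ?e ?x" and "F = ?e' ?x"
    have EF: "E * F = 1" by (simp add: E_def F_def exp_minus_inverse)
    have c: "cos ?x = (E + F) / 2" and s: "(sin ?x)\<^sup>2 = 1 - ((E + F) / 2)\<^sup>2"
      by (simp_all add: cos_exp_eq E_def F_def sin_squared_eq)
    have n: "1 - \<omega> * E \<noteq> 0" "1 - \<omega> * F \<noteq> 0"
      using slit(2)[OF less(1)] slit(2)[OF less(2)] by (simp_all add: E_def F_def)
    have prod: "(1 - \<omega> * E) * (1 - \<omega> * F) = 2 * \<omega> * (Z - cos ?x)"
    proof -
      have "2 * \<omega> * (Z - cos ?x) = \<omega> * (2 * Z) - \<omega> * (E + F)"
        by (simp add: c algebra_simps)
      also have "\<dots> = \<omega>\<^sup>2 * (E * F) + 1 - \<omega> * (E + F)"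
        unfolding Z using assms(1) by (simp add: EF field_simps power2_eq_square)
      finally show ?thesis by (simp add: algebra_simps power2_eq_square)
    qed
    hence Zc: "Z - cos ?x \<noteq> 0" using n assms(1) by auto
    define k where "k = (1 - \<omega>\<^sup>2) / (2 * \<omega>)"
    have i1: "\<i> * (0 - \<omega> * (E * \<i>)) = \<omega> * E" and i2: "\<i> * (0 - \<omega> * (F * (- \<i>))) = - (\<omega> * F)"
      by (simp_all add: complex_eq_iff)
    have "((\<lambda>x. \<i> * Ln (1 - \<omega> * ?e x)) has_field_derivative \<i> * ((0 - \<omega> * (E * \<i>)) / (1 - \<omega> * E))) (at ?x)"
      using slit(1)[OF less(1)[of \<theta>]] unfolding E_def
      by (auto intro!: derivative_eq_intros simp: divide_inverse mult_ac)
    hence D1: "((\<lambda>x. \<i> * Ln (1 - \<omega> * ?e x)) has_field_derivative \<omega> * E / (1 - \<omega> * E)) (at ?x)"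
      unfolding times_divide_eq_right i1 .
    have "((\<lambda>x. \<i> * Ln (1 - \<omega> * ?e' x)) has_field_derivative \<i> * ((0 - \<omega> * (F * (- \<i>))) / (1 - \<omega> * F))) (at ?x)"
      using slit(1)[OF less(2)[of \<theta>]] unfolding F_def
      by (auto intro!: derivative_eq_intros simp: divide_inverse mult_ac)
    hence D2: "((\<lambda>x. \<i> * Ln (1 - \<omega> * ?e' x)) has_field_derivative - (\<omega> * F / (1 - \<omega> * F))) (at ?x)"
      unfolding times_divide_eq_right i2 minus_divide_left .
    have "(?A has_field_derivative Z + cos ?x - (1 - \<omega>\<^sup>2) / (2 * \<omega>) *
        (1 + \<omega> * E / (1 - \<omega> * E) + \<omega> * F / (1 - \<omega> * F))) (at ?x)"
      unfolding k_def[symmetric]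
      by (rule derivative_eq_intros D1 D2 refl)+ simp
    moreover have "1 + \<omega> * E / (1 - \<omega> * E) + \<omega> * F / (1 - \<omega> * F) = (1 - \<omega>\<^sup>2) / (2 * \<omega> * (Z - cos ?x))"
    proof -
      have "(1 + \<omega> * E / (1 - \<omega> * E) + \<omega> * F / (1 - \<omega> * F)) =
          (1 - \<omega>\<^sup>2 * (E * F)) / ((1 - \<omega> * E) * (1 - \<omega> * F))"
        using n by (simp add: divide_simps) (simp add: algebra_simps power2_eq_square)
      thus ?thesis by (simp add: EF prod)
    qed
    moreover have "Z + cos ?x - (1 - \<omega>\<^sup>2) / (2 * \<omega>) * ((1 - \<omega>\<^sup>2) / (2 * \<omega> * (Z - cos ?x))) =
        (sin ?x)\<^sup>2 / (Z - cos ?x)"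
    proof -
      have Z2: "((1 - \<omega>\<^sup>2) / (2 * \<omega>))\<^sup>2 = Z\<^sup>2 - 1"
        unfolding Zval using assms(1) by (simp add: field_simps power2_eq_square)
      have "(1 - \<omega>\<^sup>2) / (2 * \<omega>) * ((1 - \<omega>\<^sup>2) / (2 * \<omega> * (Z - cos ?x))) = (Z\<^sup>2 - 1) / (Z - cos ?x)"
        unfolding Z2[symmetric] by (simp add: power2_eq_square)
      also have "Z + cos ?x - \<dots> = ((Z + cos ?x) * (Z - cos ?x) - (Z\<^sup>2 - 1)) / (Z - cos ?x)"
        using Zc by (simp add: diff_divide_distrib)
      also have "(Z + cos ?x) * (Z - cos ?x) - (Z\<^sup>2 - 1) = (sin ?x)\<^sup>2"
        by (simp add: sin_squared_eq algebra_simps power2_eq_square)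
      finally show ?thesis .
    qed
    ultimately show ?thesis by simp
  qed
  have "((\<lambda>\<theta>. (sin (of_real \<theta>))\<^sup>2 / (Z - cos (of_real \<theta>))) has_integral ?A (of_real pi) - ?A (of_real 0)) {0..pi}"
    by (rule fundamental_theorem_of_calculus)
      (use has_vector_derivative_at_within[OF has_vector_derivative_real_field[OF deriv]] in auto)
  also have "?A (of_real pi) - ?A (of_real 0) = of_real pi * \<omega>"
  proof -
    have e: "exp (\<i> * of_real pi) = -1" "exp (- (\<i> * of_real pi)) = -1"
      by (simp_all add: exp_minus exp_pi_i')
    have "sin (complex_of_real pi) = 0" by (simp add: sin_of_real)
    hence "?A (of_real pi) - ?A (of_real 0) = of_real pi * (Z - (1 - \<omega>\<^sup>2) / (2 * \<omega>))"
      by (simp add: e algebra_simps)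
    also have "Z - (1 - \<omega>\<^sup>2) / (2 * \<omega>) = \<omega>"
      unfolding Zval using assms(1) by (simp add: field_simps power2_eq_square)
    finally show ?thesis .
  qed
  finally show ?thesis .
qed

text \<open>The two roots have product \<open>1\<close>, and on the unit circle \<open>\<omega> + 1 / \<omega>\<close> would be real; so one of them
  lies strictly inside.\<close>

lemma Joukowski_inverse:
  fixes Z :: complex
  assumes "Z \<notin> \<real>"
  obtains \<omega> where "\<omega> \<noteq> 0" "norm \<omega> < 1" "2 * Z = \<omega> + 1 / \<omega>"
proof -
  define r where "r = Z + csqrt (Z\<^sup>2 - 1)"
  have prod: "r * (Z - csqrt (Z\<^sup>2 - 1)) = 1"
    by (simp add: r_def algebra_simps power2_eq_square[symmetric])
  have r: "r \<noteq> 0" using prod by auto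
  moreover have "1 / r = Z - csqrt (Z\<^sup>2 - 1)"
    using prod r by (subst divide_eq_eq) (simp add: mult.commute)
  ultimately have sum: "2 * Z = r + 1 / r" by (simp add: r_def)
  have "norm r \<noteq> 1"
  proof
    assume "norm r = 1"
    hence "1 / r = cnj r" using complex_div_cnj[of 1 r] by simp
    hence "2 * Z = of_real (2 * Re r)" using sum complex_add_cnj[of r] by simp
    hence "Z = of_real (Re r)" by simp
    thus False using assms by (metis Reals_of_real)
  qed
  show thesis
  proof (cases "norm r < 1")
    case True thus ?thesis using that r sum by blast
  next
    case False
    hence "norm r > 1" using \<open>norm r \<noteq> 1\<close> by linarith
    hence "norm (1 / r) < 1" by (simp add: norm_divide divide_less_eq)
    thus ?thesis using that[of "1 / r"] r sum by (simp add: add.commute)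
  qed
qed


text \<open>For \<open>y \<noteq> 1\<close> this is the semicircle integral at the real point \<open>Z = (1 + y) / (2 sqrt y)\<close>, where
  \<open>\<omega>\<close> is the smaller one of \<open>sqrt y\<close> and \<open>1 / sqrt y\<close>.\<close>

lemma has_integral_mp_mass:
  assumes "y > 0"
  shows "((\<lambda>\<theta>. 2 / pi * (sin \<theta>)\<^sup>2 / (1 + y - 2 * sqrt y * cos \<theta>)) has_integral min 1 (1 / y)) {0..pi}"
proof (cases "y = 1")
  case False
  define r where "r = sqrt y"
  have r: "r > 0" "r \<noteq> 1" "y = r\<^sup>2" using assms False by (auto simp: r_def)
  define \<omega> where "\<omega> = (if r < 1 then r else 1 / r)"
  define Z where "Z = (1 + r\<^sup>2) / (2 * r)"
  have \<omega>: "\<omega> \<noteq> 0" "\<bar>\<omega>\<bar> < 1" "2 * Z = \<omega> + 1 / \<omega>"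
    using r by (auto simp: \<omega>_def Z_def field_simps power2_eq_square)
  have "((\<lambda>\<theta>. (sin (of_real \<theta>))\<^sup>2 / (of_real Z - cos (of_real \<theta>))) has_integral of_real pi * complex_of_real \<omega>) {0..pi}"
  proof (rule has_integral_semicircle)
    show "2 * complex_of_real Z = complex_of_real \<omega> + 1 / complex_of_real \<omega>"
      using arg_cong[OF \<omega>(3), of complex_of_real] by simp
  qed (use \<omega> in auto)
  hence "((\<lambda>\<theta>. Re ((sin (of_real \<theta>))\<^sup>2 / (of_real Z - cos (of_real \<theta>)))) has_integral Re (of_real pi * complex_of_real \<omega>)) {0..pi}"
    by (rule has_integral_Re)
  also have "(\<lambda>\<theta>. Re ((sin (of_real \<theta>))\<^sup>2 / (of_real Z - cos (of_real \<theta>)))) = (\<lambda>\<theta>. (sin \<theta>)\<^sup>2 / (Z - cos \<theta>))"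
    by (simp add: sin_of_real cos_of_real flip: of_real_diff of_real_power of_real_divide)
  finally have "((\<lambda>\<theta>. 1 / (pi * r) * ((sin \<theta>)\<^sup>2 / (Z - cos \<theta>))) has_integral 1 / (pi * r) * (pi * \<omega>)) {0..pi}"
    by (intro has_integral_mult_right) simp
  also have "1 / (pi * r) * (pi * \<omega>) = min 1 (1 / y)"
  proof (cases "r < 1")
    case True
    hence "y \<le> 1" using r by (simp add: power_le_one)
    thus ?thesis using True r assms by (simp add: \<omega>_def min_def divide_simps)
  next
    case False
    hence "y \<ge> 1" using r by (simp add: one_le_power)
    thus ?thesis using False r assms by (simp add: \<omega>_def min_def divide_simps power2_eq_square)
  qed
  also have "(\<lambda>\<theta>. 1 / (pi * r) * ((sin \<theta>)\<^sup>2 / (Z - cos \<theta>))) = (\<lambda>\<theta>. 2 / pi * (sin \<theta>)\<^sup>2 / (1 + y - 2 * sqrt y * cos \<theta>))"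
  proof
    fix \<theta> :: real
    have "1 + y - 2 * sqrt y * cos \<theta> = 2 * r * (Z - cos \<theta>)"
      using r by (simp add: Z_def r_def[symmetric] right_diff_distrib)
    thus "1 / (pi * r) * ((sin \<theta>)\<^sup>2 / (Z - cos \<theta>)) = 2 / pi * (sin \<theta>)\<^sup>2 / (1 + y - 2 * sqrt y * cos \<theta>)"
      by simp
  qed
  finally show ?thesis .
next
  case True
  \<comment> \<open>For \<open>y = 1\<close> the denominator vanishes at \<open>\<theta> = 0\<close>; cancelling \<open>1 - cos \<theta>\<close> changes the integrand at this point only.\<close>
  have "((\<lambda>\<theta>. (1 + cos \<theta>) / pi) has_integral (pi + sin pi) / pi - (0 + sin 0) / pi) {0..pi}"
    by (intro fundamental_theorem_of_calculus)
      (auto intro!: derivative_eq_intros simp flip: has_real_derivative_iff_has_vector_derivative)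
  hence "((\<lambda>\<theta>. (1 + cos \<theta>) / pi) has_integral 1) {0..pi}" by simp
  moreover have "(1 + cos \<theta>) / pi = 2 / pi * (sin \<theta>)\<^sup>2 / (1 + y - 2 * sqrt y * cos \<theta>)" if "\<theta> \<in> {0..pi} - {0}" for \<theta>
  proof -
    have "cos \<theta> \<noteq> 1" using that cos_monotone_0_pi[of 0 \<theta>] by auto
    have s: "(sin \<theta>)\<^sup>2 = (1 + cos \<theta>) * (1 - cos \<theta>)"
      by (simp add: sin_squared_eq algebra_simps power2_eq_square)
    have d: "1 + y - 2 * sqrt y * cos \<theta> = 2 * (1 - cos \<theta>)" using True by simp
    have "2 / pi * (A * e) / (2 * e) = A / pi" if "e \<noteq> 0" for A e :: real
      using that by simp
    from this[of "1 - cos \<theta>" "1 + cos \<theta>"] show ?thesis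
      unfolding s d using \<open>cos \<theta> \<noteq> 1\<close> by simp
  qed
  ultimately show ?thesis
    using True has_integral_spike_finite[of "{0}" "{0..pi}" "\<lambda>\<theta>. 2 / pi * (sin \<theta>)\<^sup>2 / (1 + y - 2 * sqrt y * cos \<theta>)"
      "\<lambda>\<theta>. (1 + cos \<theta>) / pi" 1] by simp
qed

text \<open>Parametrises the support \<open>[a, b]\<close> increasingly by \<open>[0, \<pi>]\<close>, so that the square root of
  \<open>(b - x) (x - a)\<close> becomes a multiple of \<open>sin \<theta>\<close>.\<close>

definition mp_param :: "real \<Rightarrow> real \<Rightarrow> real" where
  "mp_param y \<theta> = 1 + y - 2 * sqrt y * cos \<theta>"

lemma mp_param_simps:
  assumes "y > 0"
  shows "mp_param y 0 = (1 - sqrt y)\<^sup>2" "mp_param y pi = (1 + sqrt y)\<^sup>2"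
    and "(mp_param y has_real_derivative 2 * sqrt y * sin \<theta>) (at \<theta> within S)"
    and "mp_param y \<theta> \<in> {(1 - sqrt y)\<^sup>2..(1 + sqrt y)\<^sup>2}"
    and "\<theta> \<in> {0..pi} \<Longrightarrow> sqrt (((1 + sqrt y)\<^sup>2 - mp_param y \<theta>) * (mp_param y \<theta> - (1 - sqrt y)\<^sup>2)) = 2 * sqrt y * sin \<theta>"
proof -
  have a: "(1 - sqrt y)\<^sup>2 = 1 + y - 2 * sqrt y" and b: "(1 + sqrt y)\<^sup>2 = 1 + y + 2 * sqrt y"
    using assms by (simp_all add: power2_eq_square algebra_simps)
  show "mp_param y 0 = (1 - sqrt y)\<^sup>2" "mp_param y pi = (1 + sqrt y)\<^sup>2"
    unfolding a b by (simp_all add: mp_param_def)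
  show "(mp_param y has_real_derivative 2 * sqrt y * sin \<theta>) (at \<theta> within S)"
    unfolding mp_param_def[abs_def] by (auto intro!: derivative_eq_intros)
  have "sqrt y * cos \<theta> \<le> sqrt y * 1" "sqrt y * (- 1) \<le> sqrt y * cos \<theta>"
    using assms by (intro mult_left_mono; simp)+
  thus "mp_param y \<theta> \<in> {(1 - sqrt y)\<^sup>2..(1 + sqrt y)\<^sup>2}"
    unfolding a b by (simp add: mp_param_def)
  assume "\<theta> \<in> {0..pi}"
  hence nn: "2 * sqrt y * sin \<theta> \<ge> 0" using assms by (simp add: sin_ge_zero)
  have "((1 + sqrt y)\<^sup>2 - mp_param y \<theta>) * (mp_param y \<theta> - (1 - sqrt y)\<^sup>2) = (2 * sqrt y)\<^sup>2 * ((1 + cos \<theta>) * (1 - cos \<theta>))"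
    unfolding a b mp_param_def by (simp add: algebra_simps power2_eq_square)
  also have "(1 + cos \<theta>) * (1 - cos \<theta>) = (sin \<theta>)\<^sup>2"
    by (simp add: sin_squared_eq algebra_simps power2_eq_square)
  finally show "sqrt (((1 + sqrt y)\<^sup>2 - mp_param y \<theta>) * (mp_param y \<theta> - (1 - sqrt y)\<^sup>2)) = 2 * sqrt y * sin \<theta>"
    using nn by (intro real_sqrt_unique) (simp_all add: power_mult_distrib)
qed

lemma nn_integral_mp_density:
  assumes "y > 0"
  shows "(\<integral>\<^sup>+x. ennreal (mp_density y x) \<partial>lborel) = ennreal (min 1 (1 / y))"
proof -
  define r where "r = sqrt y"
  have r: "r > 0" "y = r\<^sup>2" using assms by (auto simp: r_def)
  let ?a = "(1 - sqrt y)\<^sup>2" and ?b = "(1 + sqrt y)\<^sup>2"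
  let ?f = "\<lambda>x. sqrt ((?b - x) * (x - ?a)) / (2 * pi * x * y)"
  let ?h = "\<lambda>\<theta>. 2 / pi * (sin \<theta>)\<^sup>2 / (1 + y - 2 * sqrt y * cos \<theta>)"
  have "(\<integral>\<^sup>+x. ennreal (mp_density y x) \<partial>lborel) =
      (\<integral>\<^sup>+x. ?f x * indicator {mp_param y 0..mp_param y pi} x \<partial>lborel)"
    by (simp add: mp_density_def Let_def mp_param_simps(1,2)[OF assms])
  also have "\<dots> = (\<integral>\<^sup>+\<theta>. ?f (mp_param y \<theta>) * (2 * sqrt y * sin \<theta>) * indicator {0..pi} \<theta> \<partial>lborel)"
    by (rule nn_integral_substitution)
      (use assms mp_param_simps(3)[OF assms, of _ UNIV] in
        \<open>auto intro!: continuous_intros mult_nonneg_nonneg sin_ge_zero simp: set_borel_measurable_def\<close>)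
  also have "\<dots> = (\<integral>\<^sup>+\<theta>. ennreal (if \<theta> \<in> {0..pi} then ?h \<theta> else 0) \<partial>lborel)"
  proof (rule nn_integral_cong)
    fix \<theta> :: real
    have "?f (mp_param y \<theta>) * (2 * sqrt y * sin \<theta>) = ?h \<theta>" if "\<theta> \<in> {0..pi}"
    proof -
      have "(2 * r * s) / (2 * pi * D * r\<^sup>2) * (2 * r * s) = 2 / pi * s\<^sup>2 / D" for s D
        using r by (cases "D = 0") (simp_all add: field_simps power2_eq_square)
      from this[of "sin \<theta>" "mp_param y \<theta>"] show ?thesis
        unfolding mp_param_simps(5)[OF assms that] r_def using assms by (simp add: mp_param_def)
    qed
    thus "ennreal (?f (mp_param y \<theta>) * (2 * sqrt y * sin \<theta>) * indicator {0..pi} \<theta>) =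
        ennreal (if \<theta> \<in> {0..pi} then ?h \<theta> else 0)"
      by (auto simp: indicator_def)
  qed
  also have "\<dots> = ennreal (min 1 (1 / y))"
  proof (rule nn_integral_has_integral_lborel)
    show "((\<lambda>\<theta>. if \<theta> \<in> {0..pi} then ?h \<theta> else 0) has_integral min 1 (1 / y)) UNIV"
      using has_integral_mp_mass[OF assms] by (subst has_integral_restrict_UNIV)
    have "?h \<theta> \<ge> 0" for \<theta>
    proof -
      have "mp_param y \<theta> \<ge> 0"
        using mp_param_simps(4)[OF assms, of \<theta>] order_trans[OF zero_le_power2] by auto
      thus ?thesis by (auto simp: mp_param_def intro!: divide_nonneg_nonneg)
    qed
    thus "0 \<le> (if \<theta> \<in> {0..pi} then ?h \<theta> else 0)" for \<theta> by simp
  qed auto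
  finally show ?thesis .
qed

lemma emeasure_mp_law_UNIV:
  assumes "y > 0"
  shows "emeasure (mp_law y) UNIV = 1"
  using assms by (subst emeasure_mp_law)
    (auto simp: nn_integral_mp_density min_def ennreal_plus[symmetric] simp del: ennreal_plus)

text \<open>Off the origin the law has density \<^const>\<open>mp_density\<close>, and a function vanishing at \<open>0\<close> does not see
  the atom.\<close>

lemma integral_mp_law_vanishing_at_0:
  fixes f :: "real \<Rightarrow> complex"
  assumes "y > 0" and [measurable]: "f \<in> borel_measurable borel" and "f 0 = 0"
  shows "(\<integral>x. f x \<partial>mp_law y) = (\<integral>x. mp_density y x *\<^sub>R f x \<partial>lborel)"
proof -
  have "density (mp_law y) (indicator (- {0})) = density lborel (\<lambda>x. ennreal (mp_density y x))"
  proof (rule measure_eqI)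
    fix A assume "A \<in> sets (density (mp_law y) (indicator (- {0})))"
    hence A[measurable]: "A \<in> sets borel" by simp
    have "emeasure (density (mp_law y) (indicator (- {0}))) A = (\<integral>\<^sup>+x. indicator (A - {0}) x \<partial>mp_law y)"
      by (subst emeasure_density) (auto intro!: nn_integral_cong split: split_indicator simp del: nn_integral_indicator)
    also have "\<dots> = emeasure (mp_law y) (A - {0})" by simp
    also have "\<dots> = (\<integral>\<^sup>+x\<in>A - {0}. ennreal (mp_density y x) \<partial>lborel)"
      by (subst emeasure_mp_law) auto
    also have "\<dots> = (\<integral>\<^sup>+x\<in>A. ennreal (mp_density y x) \<partial>lborel)"
    proof (rule nn_integral_cong_AE)
      show "AE x in lborel. ennreal (mp_density y x) * indicator (A - {0}) x = ennreal (mp_density y x) * indicator A x"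
        using AE_lborel_singleton[of 0] by (rule eventually_mono) (simp add: indicator_def)
    qed
    also have "\<dots> = emeasure (density lborel (\<lambda>x. ennreal (mp_density y x))) A"
      by (simp add: emeasure_density)
    finally show "emeasure (density (mp_law y) (indicator (- {0}))) A =
      emeasure (density lborel (\<lambda>x. ennreal (mp_density y x))) A" .
  qed simp
  hence eq: "density (mp_law y) (\<lambda>x. ennreal (indicator (- {0}) x)) = density lborel (\<lambda>x. ennreal (mp_density y x))"
    by (simp add: ennreal_indicator)
  have nonneg: "mp_density y x \<ge> 0" for x
    using assms(1) order_trans[OF zero_le_power2, of "1 - sqrt y" x]
    by (auto simp: mp_density_def Let_def indicator_def intro!: divide_nonneg_nonneg)
  have "(\<integral>x. f x \<partial>mp_law y) = (\<integral>x. indicator (- {0}) x *\<^sub>R f x \<partial>mp_law y)"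
    using assms(3) by (intro Bochner_Integration.integral_cong) (auto simp: indicator_def)
  also have "\<dots> = (\<integral>x. f x \<partial>density (mp_law y) (\<lambda>x. ennreal (indicator (- {0}) x)))"
    by (rule integral_density[symmetric]) auto
  also have "\<dots> = (\<integral>x. mp_density y x *\<^sub>R f x \<partial>lborel)"
    unfolding eq using nonneg by (subst integral_density) auto
  finally show ?thesis .
qed

text \<open>Since the total mass is one, \<open>1 - z / (z - x) = - x / (z - x)\<close> integrates to the left-hand side.
  The new integrand vanishes at \<open>0\<close>, which removes the atom of the case \<open>y > 1\<close>.\<close>

lemma one_minus_z_mp_stieltjes:
  assumes "y > 0" "z \<notin> \<real>"
  shows "1 - z * mp_stieltjes y z = - (\<integral>x. mp_density y x *\<^sub>R (of_real x / (z - of_real x)) \<partial>lborel)"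
proof -
  interpret finite_measure "mp_law y" by (rule finite_measureI) (simp add: emeasure_mp_law_UNIV[OF assms(1)])
  have ne: "z - of_real x \<noteq> 0" for x using assms(2) by (auto simp: complex_is_Real_iff)
  have im: "Im z \<noteq> 0" using assms(2) by (simp add: complex_is_Real_iff)
  have "norm (1 / (z - of_real x)) \<le> 1 / \<bar>Im z\<bar>" for x
    using abs_Im_le_cmod[of "z - of_real x"] im by (auto simp: norm_divide intro!: divide_left_mono mult_pos_pos)
  hence int: "integrable (mp_law y) (\<lambda>x. 1 / (z - of_real x))"
    by (intro integrable_const_bound) auto
  have *: "of_real x / (z - of_real x) = z * (1 / (z - of_real x)) - 1" for x
    using ne[of x] by (simp add: field_simps)
  have "(\<integral>x. of_real x / (z - of_real x) \<partial>mp_law y) =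
      (\<integral>x. z * (1 / (z - of_real x)) \<partial>mp_law y) - (\<integral>x. 1 \<partial>mp_law y)"
    unfolding * by (rule Bochner_Integration.integral_diff[OF integrable_mult_right[OF int] integrable_const])
  also have "\<dots> = z * mp_stieltjes y z - 1"
    by (simp only: integral_mult_right_zero mp_stieltjes_def)
       (simp add: measure_def emeasure_mp_law_UNIV[OF assms(1)])
  finally have "(\<integral>x. of_real x / (z - of_real x) \<partial>mp_law y) = z * mp_stieltjes y z - 1" .
  moreover have "(\<integral>x. of_real x / (z - of_real x) \<partial>mp_law y) = (\<integral>x. mp_density y x *\<^sub>R (of_real x / (z - of_real x)) \<partial>lborel)"
    by (rule integral_mp_law_vanishing_at_0) (use assms in auto)
  ultimately show ?thesis by simp
qed

lemma mp_stieltjes_Joukowski: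
  assumes "y > 0" "z \<notin> \<real>"
  obtains \<omega> where "\<omega> \<noteq> 0" "norm \<omega> < 1" "z = 1 + of_real y + of_real (sqrt y) * (\<omega> + 1 / \<omega>)"
    "1 - z * mp_stieltjes y z = - \<omega> / of_real (sqrt y)"
proof -
  define r where "r = sqrt y"
  have r: "r > 0" "y = r\<^sup>2" using assms(1) by (auto simp: r_def)
  let ?a = "(1 - sqrt y)\<^sup>2" and ?b = "(1 + sqrt y)\<^sup>2"
  define Z where "Z = (z - 1 - of_real y) / of_real (2 * r)"
  have im: "Im z \<noteq> 0" using assms(2) by (simp add: complex_is_Real_iff)
  have ne: "z - of_real x \<noteq> 0" for x using im by auto
  have "Im Z = Im z / (2 * r)" unfolding Z_def by (simp only: Im_divide_of_real) simp
  hence "Z \<notin> \<real>" using im r by (simp add: complex_is_Real_iff)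
  then obtain \<omega> where \<omega>: "\<omega> \<noteq> 0" "norm \<omega> < 1" "2 * Z = \<omega> + 1 / \<omega>"
    by (rule Joukowski_inverse)
  have zZ: "z - 1 - of_real y = of_real r * (2 * Z)" using r by (simp add: Z_def)
  have z: "z = 1 + of_real y + of_real (sqrt y) * (\<omega> + 1 / \<omega>)"
    using zZ unfolding \<omega>(3) r_def by (simp add: algebra_simps)
  let ?F = "\<lambda>x. complex_of_real (sqrt ((?b - x) * (x - ?a)) / (2 * pi * y)) / (z - of_real x)"
  have cont: "continuous_on {?a..?b} ?F"
    using ne assms(1) by (auto intro!: continuous_intros)
  have "(\<integral>x. mp_density y x *\<^sub>R (of_real x / (z - of_real x)) \<partial>lborel) = (LINT x:{?a..?b}|lborel. ?F x)"
    unfolding set_lebesgue_integral_def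
  proof (rule Bochner_Integration.integral_cong[OF refl])
    fix x :: real
    \<comment> \<open>The factor \<open>x\<close> cancels the \<open>1 / x\<close> of the density.  At \<open>x = 0\<close> the density is \<open>0\<close> by the convention on division, and so is the other side: \<open>0\<close> lies in \<open>[a, b]\<close> only if \<open>a = 0\<close>.\<close>
    show "mp_density y x *\<^sub>R (of_real x / (z - of_real x)) = indicator {?a..?b} x *\<^sub>R ?F x"
    proof (cases "x = 0 \<and> x \<in> {?a..?b}")
      case True
      hence "?a = 0" using zero_le_power2[of "1 - sqrt y"] by (auto intro: antisym)
      thus ?thesis using True by simp
    next
      case False
      thus ?thesis using assms(1)
        by (auto simp: mp_density_def Let_def scaleR_conv_of_real indicator_def)
    qed
  qed
  also have "\<dots> = integral {?a..?b} ?F"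
    using borel_integrable_atLeastAtMost'[OF cont] by (rule set_borel_integral_eq_integral(2))
  also have "\<dots> = of_real (1 / r) * \<omega>"
  proof (rule has_integral_unique)
    have "((\<lambda>\<theta>. (2 * sqrt y * sin \<theta>) *\<^sub>R ?F (mp_param y \<theta>)) has_integral
        integral {mp_param y 0..mp_param y pi} ?F) {0..pi}"
    proof (rule has_integral_substitution)
      show "mp_param y 0 \<le> mp_param y pi"
        using mp_param_simps(4)[OF assms(1), of 0] by (auto simp: mp_param_simps(2)[OF assms(1)])
      show "mp_param y ` {0..pi} \<subseteq> {?a..?b}" using mp_param_simps(4)[OF assms(1)] by blast
    qed (use cont mp_param_simps(3)[OF assms(1)] in auto)
    thus "((\<lambda>\<theta>. (2 * sqrt y * sin \<theta>) *\<^sub>R ?F (mp_param y \<theta>)) has_integral integral {?a..?b} ?F) {0..pi}"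
      by (simp only: mp_param_simps(1,2)[OF assms(1)])
    \<comment> \<open>Since \<open>z - x = - 2 r (- Z - cos \<theta>)\<close> for \<open>x = 1 + y - 2 r cos \<theta>\<close>, the semicircle integral is taken at \<open>- Z\<close>, whose root is \<open>- \<omega>\<close>.\<close>
    have "((\<lambda>\<theta>. of_real (- 1 / (pi * r)) * ((sin (of_real \<theta>))\<^sup>2 / (- Z - cos (of_real \<theta>)))) has_integral
        of_real (- 1 / (pi * r)) * (of_real pi * - \<omega>)) {0..pi}"
      by (intro has_integral_mult_right has_integral_semicircle) (use \<omega> in auto)
    also have "of_real (- 1 / (pi * r)) * (of_real pi * - \<omega>) = of_real (1 / r) * \<omega>"
      by simp
    finally show "((\<lambda>\<theta>. (2 * sqrt y * sin \<theta>) *\<^sub>R ?F (mp_param y \<theta>)) has_integral of_real (1 / r) * \<omega>) {0..pi}"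
    proof (rule has_integral_eq[rotated])
      fix \<theta> assume \<theta>: "\<theta> \<in> {0..pi}"
      define s where "s = sin \<theta>"
      define W where "W = - Z - cos (of_real \<theta>)"
      have W: "z - of_real (mp_param y \<theta>) = - 2 * of_real r * W"
        using zZ by (simp add: mp_param_def r_def[symmetric] W_def cos_of_real algebra_simps)
      hence W0: "W \<noteq> 0" using ne[of "mp_param y \<theta>"] by auto
      have sq: "sqrt ((?b - mp_param y \<theta>) * (mp_param y \<theta> - ?a)) = 2 * r * s"
        using mp_param_simps(5)[OF assms(1) \<theta>] by (simp add: r_def s_def)
      have "(2 * sqrt y * sin \<theta>) *\<^sub>R ?F (mp_param y \<theta>) =
          of_real (2 * r * s) * (of_real (2 * r * s / (2 * pi * r\<^sup>2)) / (- 2 * of_real r * W))"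
        unfolding sq W r(2)[symmetric] by (simp add: scaleR_conv_of_real r_def s_def)
      also have "\<dots> = of_real (- 1 / (pi * r)) * ((of_real s)\<^sup>2 / W)"
        using W0 r(1) by (simp add: field_simps power2_eq_square)
      finally show "of_real (- 1 / (pi * r)) * ((sin (of_real \<theta>))\<^sup>2 / (- Z - cos (of_real \<theta>))) =
          (2 * sqrt y * sin \<theta>) *\<^sub>R ?F (mp_param y \<theta>)"
        by (simp add: W_def s_def sin_of_real)
    qed
  qed
  finally have "1 - z * mp_stieltjes y z = - \<omega> / of_real (sqrt y)"
    unfolding one_minus_z_mp_stieltjes[OF assms] by (simp add: r_def)
  thus thesis using that \<omega>(1,2) z by blast
qed

text \<open>Both claims are read off from the parametrisation by \<open>\<omega>\<close>.  For the sign,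
  \<open>Im (\<omega> + 1 / \<omega>) = Im \<omega> (1 - 1 / \<bar>\<omega>\<bar>\<^sup>2)\<close> has the sign opposite to \<open>Im \<omega>\<close>.\<close>

lemma mp_stieltjes_quadratic:
  assumes "y > 0" "z \<notin> \<real>"
  defines "u \<equiv> 1 - z * mp_stieltjes y z"
  shows "of_real y * u\<^sup>2 + (z - 1 - of_real y) * u + 1 = 0" and "Im z * Im u > 0"
proof -
  obtain \<omega> where \<omega>: "\<omega> \<noteq> 0" "norm \<omega> < 1" and z: "z = 1 + of_real y + of_real (sqrt y) * (\<omega> + 1 / \<omega>)"
    and u: "u = - \<omega> / of_real (sqrt y)"
    unfolding u_def by (rule mp_stieltjes_Joukowski[OF assms(1,2)])
  define r where "r = sqrt y"
  have r: "r > 0" "y = r\<^sup>2" using assms(1) by (auto simp: r_def)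
  have "of_real y * u\<^sup>2 = \<omega>\<^sup>2"
    using r(1) unfolding u r_def[symmetric] r(2) by (simp add: field_simps)
  moreover have "(z - 1 - of_real y) * u = - (\<omega>\<^sup>2 + 1)"
    using r(1) \<omega>(1) unfolding u z r_def[symmetric] by (simp add: field_simps power2_eq_square)
  ultimately show "of_real y * u\<^sup>2 + (z - 1 - of_real y) * u + 1 = 0" by simp
  have n: "(norm \<omega>)\<^sup>2 > 0" "(norm \<omega>)\<^sup>2 < 1" using \<omega> abs_square_less_1[of "norm \<omega>"] by auto
  have "Im (1 / \<omega>) = - Im \<omega> / (norm \<omega>)\<^sup>2"
    by (simp add: Im_divide cmod_power2)
  note * = this
  have imz: "Im z = r * (Im \<omega> * (1 - 1 / (norm \<omega>)\<^sup>2))"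
  proof -
    have "Im z = r * (Im \<omega> + Im (1 / \<omega>))"
      unfolding z r_def[symmetric] by simp
    thus ?thesis unfolding * by (simp add: right_diff_distrib)
  qed
  have imu: "Im u = - Im \<omega> / r" unfolding u r_def[symmetric] by simp
  have "Im \<omega> \<noteq> 0" using imz assms(2) by (auto simp: complex_is_Real_iff)
  hence "(Im \<omega>)\<^sup>2 * (1 / (norm \<omega>)\<^sup>2 - 1) > 0" using n by (intro mult_pos_pos) auto
  also have "(Im \<omega>)\<^sup>2 * (1 / (norm \<omega>)\<^sup>2 - 1) = Im z * Im u"
    unfolding imz imu using r(1) by (simp add: power2_eq_square algebra_simps)
  finally show "Im z * Im u > 0" .
qed

lemma mp_stieltjes_holomorphic:
  assumes "y > 0"
  shows "mp_stieltjes y holomorphic_on (- \<real>)"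
  unfolding mp_stieltjes_def[abs_def]
proof (rule holomorphic_on_lebesgue_integral)
  interpret finite_measure "mp_law y" by (rule finite_measureI) (simp add: emeasure_mp_law_UNIV[OF assms(1)])
  show "open (- \<real> :: complex set)" using closed_complex_Reals by (rule open_Compl)
  show "(\<lambda>z. 1 / (z - complex_of_real x)) holomorphic_on - \<real>" for x
    by (auto intro!: holomorphic_intros)
  fix z0 :: complex assume z0: "z0 \<in> - \<real>"
  define d where "d = \<bar>Im z0\<bar> / 2"
  have d: "d > 0" using z0 by (auto simp: d_def complex_is_Real_iff)
  have "norm (1 / (z - complex_of_real x)) \<le> 1 / d" if "z \<in> ball z0 d" for z x
  proof -
    have "\<bar>Im (z0 - z)\<bar> < d" using that abs_Im_le_cmod[of "z0 - z"] by (simp add: dist_norm)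
    hence "d \<le> \<bar>Im z\<bar>" unfolding d_def minus_complex.simps by linarith
    also have "\<dots> \<le> norm (z - complex_of_real x)"
      using abs_Im_le_cmod[of "z - of_real x"] by simp
    finally show ?thesis using d by (simp add: norm_divide frac_le)
  qed
  thus "\<exists>r>0. \<exists>g. integrable (mp_law y) g \<and> (\<forall>z\<in>ball z0 r \<inter> - \<real>. \<forall>x\<in>space (mp_law y). norm (1 / (z - complex_of_real x)) \<le> g x)"
    using d by (intro exI[of _ d] conjI exI[of _ "\<lambda>_. 1 / d"]) auto
qed auto

section \<open>The mixed derivative and its separation of variables\<close>

lemma has_field_derivative_powr_const_exponent:
  fixes f :: "complex \<Rightarrow> complex"
  assumes "(f has_field_derivative f') (at z)" "Re (f z) > 0"
  shows "((\<lambda>z. f z powr a) has_field_derivative a * f z powr (a - 1) * f') (at z)"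
proof -
  have "f z \<notin> \<real>\<^sub>\<le>\<^sub>0" using assms(2) by (auto simp: complex_nonpos_Reals_iff)
  thus ?thesis
    using DERIV_chain2[OF has_field_derivative_powr assms(1)] by simp
qed

definition power_defect :: "complex \<Rightarrow> complex \<Rightarrow> complex \<Rightarrow> complex" where
  "power_defect b X Y = (X + Y) powr b - X powr b - Y powr b"

lemma power_defect_derivative:
  assumes "(f has_field_derivative f') (at z)" "Re (f z) > 0" "Re Y > 0"
  shows "((\<lambda>z. power_defect b (f z) Y) has_field_derivative
      b * ((f z + Y) powr (b - 1) - f z powr (b - 1)) * f') (at z)"
proof -
  have 1: "((\<lambda>z. f z + Y) has_field_derivative f') (at z)" "Re (f z + Y) > 0"
    using assms by (auto intro!: derivative_eq_intros)
  show ?thesis unfolding power_defect_def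
    using DERIV_diff[OF DERIV_diff[OF has_field_derivative_powr_const_exponent[OF 1, of b]
        has_field_derivative_powr_const_exponent[OF assms(1,2), of b]] DERIV_const[of "Y powr b"]]
    by (simp add: right_diff_distrib left_diff_distrib)
qed

lemma power_defect_commute: "power_defect b X Y = power_defect b Y X"
  by (simp add: power_defect_def add.commute)

text \<open>Here \<open>p\<close> and \<open>P\<close> are the functions with \<open>K(z,t) = t p(z)\<close> and \<open>K(w,s) = s P(w)\<close>.  Every
  derivative of the exponential contributes a factor \<open>t\<close> or \<open>s\<close>, and so does every derivative of
  the powers; these cancel the denominator \<open>t s\<close>.\<close>

lemma mixed_derivative_power_defect:
  fixes p q P Q :: "complex \<Rightarrow> complex" and t s :: real
  assumes "t > 0" "s > 0"
    and z: "(p has_field_derivative p') (at z)" "(q has_field_derivative q') (at z)" "Re (p z) > 0"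
    and w: "(P has_field_derivative P') (at w)" "(Q has_field_derivative Q') (at w)" "Re (P w) > 0"
    and pos: "\<forall>\<^sub>F v in nhds z. Re (p v) > 0"
  defines "X \<equiv> of_real t * p z" and "Y \<equiv> of_real s * P w"
  shows "deriv (\<lambda>v. deriv (\<lambda>w'. k / of_real (t * s) * exp (- (of_real t * q v + of_real s * Q w')) *
        power_defect b (of_real t * p v) (of_real s * P w')) w) z =
    k * exp (- (of_real t * q z + of_real s * Q w)) *
      (q' * Q' * power_defect b X Y
       - q' * P' * (b * ((X + Y) powr (b - 1) - Y powr (b - 1)))
       - Q' * p' * (b * ((X + Y) powr (b - 1) - X powr (b - 1)))
       + p' * P' * (b * (b - 1) * (X + Y) powr (b - 2)))"
proof -
  have Y: "Re Y > 0" using assms by (simp add: Y_def)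
  define T S where "T = complex_of_real t" and "S = complex_of_real s"
  have TS: "T \<noteq> 0" "S \<noteq> 0" using assms(1,2) by (auto simp: T_def S_def)
  let ?D = "\<lambda>v. k / T * exp (- (T * q v + S * Q w)) *
      (P' * (b * ((T * p v + Y) powr (b - 1) - Y powr (b - 1))) - Q' * power_defect b (T * p v) Y)"
  have inner: "deriv (\<lambda>w'. k / of_real (t * s) * exp (- (T * q v + S * Q w')) *
        power_defect b (T * p v) (S * P w')) w = ?D v" if "Re (p v) > 0" for v
  proof (rule DERIV_imp_deriv)
    have pv: "Re (T * p v) > 0" using that assms(1) by (simp add: T_def)
    have "((\<lambda>w'. S * P w') has_field_derivative S * P') (at w)"
      using w(1) by (rule DERIV_cmult)
    from power_defect_derivative[OF this _ pv, of b] 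
    have 1: "((\<lambda>w'. power_defect b (T * p v) (S * P w')) has_field_derivative
        b * ((T * p v + Y) powr (b - 1) - Y powr (b - 1)) * (S * P')) (at w)"
      using Y by (simp add: power_defect_commute[of b "T * p v"] Y_def S_def add.commute)
    have 2: "((\<lambda>w'. exp (- (T * q v + S * Q w'))) has_field_derivative
        - (S * Q') * exp (- (T * q v + S * Q w))) (at w)"
      using w(2) by (auto intro!: derivative_eq_intros)
    have kTS: "k / of_real (t * s) = k / (T * S)" by (simp add: T_def S_def)
    show "((\<lambda>w'. k / of_real (t * s) * exp (- (T * q v + S * Q w')) *
        power_defect b (T * p v) (S * P w')) has_field_derivative ?D v) (at w)"
      unfolding kTS
      by (rule derivative_eq_intros 1 2 refl)+ (use TS in \<open>simp add: Y_def S_def[symmetric] field_simps\<close>)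
  qed
  have "deriv (\<lambda>v. deriv (\<lambda>w'. k / of_real (t * s) * exp (- (of_real t * q v + of_real s * Q w')) *
        power_defect b (of_real t * p v) (of_real s * P w')) w) z = deriv ?D z"
    using pos unfolding T_def[symmetric] S_def[symmetric]
    by (intro deriv_cong_ev refl) (erule eventually_mono, erule inner)
  also have "\<dots> = k * exp (- (T * q z + S * Q w)) *
      (q' * Q' * power_defect b X Y
       - q' * P' * (b * ((X + Y) powr (b - 1) - Y powr (b - 1)))
       - Q' * p' * (b * ((X + Y) powr (b - 1) - X powr (b - 1)))
       + p' * P' * (b * (b - 1) * (X + Y) powr (b - 2)))" (is "_ = ?R")
  proof (rule DERIV_imp_deriv)
    have X: "Re (T * p z) > 0" using z(3) assms(1) by (simp add: T_def)
    have d: "((\<lambda>v. T * p v) has_field_derivative T * p') (at z)"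
      using z(1) by (rule DERIV_cmult)
    note 1 = power_defect_derivative[OF d X Y, of b]
    have "((\<lambda>v. T * p v + Y) has_field_derivative T * p') (at z)"
      using z(1) by (auto intro!: derivative_eq_intros)
    from has_field_derivative_powr_const_exponent[OF this, of "b - 1"] X Y
    have 2: "((\<lambda>v. (T * p v + Y) powr (b - 1)) has_field_derivative
        (b - 1) * (T * p z + Y) powr (b - 2) * (T * p')) (at z)" by simp
    have 3: "((\<lambda>v. exp (- (T * q v + S * Q w))) has_field_derivative
        - (T * q') * exp (- (T * q z + S * Q w))) (at z)"
      using z(2) by (auto intro!: derivative_eq_intros)
    show "(?D has_field_derivative ?R) (at z)"
      unfolding X_def T_def[symmetric]
      by (rule derivative_eq_intros 1 2 3 refl)+ (use TS(1) in \<open>simp add: field_simps\<close>)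
  qed
  finally show ?thesis unfolding T_def S_def .
qed

text \<open>The derivative in \<open>z\<close> of \<open>exp (- t q(z)) * (1 - exp (- \<tau> t p(z))) / t\<close>, given the values and
  derivatives of \<open>p\<close> and \<open>q\<close> at \<open>z\<close>.\<close>

definition laplace_factor :: "complex \<Rightarrow> complex \<Rightarrow> complex \<Rightarrow> complex \<Rightarrow> real \<Rightarrow> real \<Rightarrow> complex" where
  "laplace_factor p p' q q' \<tau> t = exp (- (of_real t * q)) *
     (of_real \<tau> * p' * exp (- (of_real \<tau> * (of_real t * p))) - q' * (1 - exp (- (of_real \<tau> * (of_real t * p)))))"

lemma measurable_laplace_factor [measurable]:
  assumes "f \<in> borel_measurable M" "g \<in> borel_measurable M"
  shows "(\<lambda>x. laplace_factor p p' q q' (f x) (g x)) \<in> borel_measurable M"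
  using assms unfolding laplace_factor_def by measurable

text \<open>Separation of variables: the bracket is the mixed derivative from
  \<open>mixed_derivative_power_defect\<close>, and expanding the product of the two factors produces its
  four terms, matched by the integrals of \<open>power_kernel_2\<close>, \<open>power_kernel_1\<close> (twice) and
  \<open>power_kernel_0\<close>.\<close>

lemma laplace_factor_integral_representation:
  fixes \<beta> t s :: real
  assumes \<beta>: "1 < \<beta>" "\<beta> < 2" and ts: "t > 0" "s > 0" and "Re p > 0" "Re P > 0"
  defines "X \<equiv> of_real t * p" and "Y \<equiv> of_real s * P" and "b \<equiv> complex_of_real \<beta>"
  shows "of_real (\<beta> * (\<beta> - 1)) * (LINT \<tau>:{0<..}|lborel. of_real (\<tau> powr (- \<beta> - 1)) *
      (laplace_factor p p' q q' \<tau> t * laplace_factor P P' Q Q' \<tau> s)) =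
    of_real (Gamma (2 - \<beta>)) * (exp (- (of_real t * q + of_real s * Q)) *
      (q' * Q' * power_defect b X Y
       - q' * P' * (b * ((X + Y) powr (b - 1) - Y powr (b - 1)))
       - Q' * p' * (b * ((X + Y) powr (b - 1) - X powr (b - 1)))
       + p' * P' * (b * (b - 1) * (X + Y) powr (b - 2))))"
proof -
  have X: "Re X > 0" and Y: "Re Y > 0" using assms by (auto simp: X_def Y_def)
  have XY: "Re (X + Y) > 0" using X Y by simp
  let ?E = "\<lambda>X \<tau>. exp (- (complex_of_real \<tau> * X))"
  let ?e = "exp (- (of_real t * q + of_real s * Q))"
  let ?f = "\<lambda>\<tau>. of_real (\<tau> powr (- \<beta> - 1)) * ((1 - ?E X \<tau>) * (1 - ?E Y \<tau>))"
  let ?g = "\<lambda>X Y \<tau>. of_real (\<tau> powr (- \<beta>)) * (?E X \<tau> * (1 - ?E Y \<tau>))"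
  let ?h = "\<lambda>X \<tau>. of_real (\<tau> powr (1 - \<beta>)) * ?E X \<tau>"
  note int = power_kernel_2_integrable[OF \<beta> X Y] power_kernel_1_integrable[OF \<beta> X Y]
    power_kernel_1_integrable[OF \<beta> Y X] power_kernel_0(1)[OF \<beta> XY]
  have "(LINT \<tau>:{0<..}|lborel. of_real (\<tau> powr (- \<beta> - 1)) *
      (laplace_factor p p' q q' \<tau> t * laplace_factor P P' Q Q' \<tau> s)) =
    (LINT \<tau>:{0<..}|lborel. ?e * (q' * Q' * ?f \<tau> - q' * P' * ?g Y X \<tau> - Q' * p' * ?g X Y \<tau> + p' * P' * ?h (X + Y) \<tau>))"
  proof (rule set_lebesgue_integral_cong)
    show "\<forall>\<tau>. \<tau> \<in> {0<..} \<longrightarrow> of_real (\<tau> powr (- \<beta> - 1)) *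
      (laplace_factor p p' q q' \<tau> t * laplace_factor P P' Q Q' \<tau> s) =
      ?e * (q' * Q' * ?f \<tau> - q' * P' * ?g Y X \<tau> - Q' * p' * ?g X Y \<tau> + p' * P' * ?h (X + Y) \<tau>)"
    proof safe
      fix \<tau> :: real assume \<tau>: "\<tau> > 0"
      define W where "W = complex_of_real (\<tau> powr (- \<beta> - 1))"
      have "\<tau> powr (- \<beta>) = \<tau> powr (- \<beta> - 1) * \<tau>"
        using \<tau> by (simp add: powr_diff)
      hence W1: "complex_of_real (\<tau> powr (- \<beta>)) = W * of_real \<tau>"
        unfolding W_def by (metis of_real_mult)
      have "\<tau> powr (1 - \<beta>) = \<tau> powr (- \<beta> - 1) * \<tau> * \<tau>"
        using \<tau> by (simp add: powr_diff powr_minus field_simps)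
      hence W2: "complex_of_real (\<tau> powr (1 - \<beta>)) = W * of_real \<tau> * of_real \<tau>"
        unfolding W_def by (metis of_real_mult)
      have e: "?e = exp (- (of_real t * q)) * exp (- (of_real s * Q))"
        by (simp add: exp_add[symmetric])
      have EXY: "?E (X + Y) \<tau> = ?E X \<tau> * ?E Y \<tau>"
        by (simp add: exp_add[symmetric] algebra_simps)
      show "of_real (\<tau> powr (- \<beta> - 1)) *
        (laplace_factor p p' q q' \<tau> t * laplace_factor P P' Q Q' \<tau> s) =
        ?e * (q' * Q' * ?f \<tau> - q' * P' * ?g Y X \<tau> - Q' * p' * ?g X Y \<tau> + p' * P' * ?h (X + Y) \<tau>)"
        unfolding laplace_factor_def X_def[symmetric] Y_def[symmetric] e EXY W1 W2 W_def[symmetric]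
        by (simp add: algebra_simps)
    qed
  qed auto
  also have "\<dots> = ?e * (q' * Q' * (LINT \<tau>:{0<..}|lborel. ?f \<tau>) - q' * P' * (LINT \<tau>:{0<..}|lborel. ?g Y X \<tau>)
      - Q' * p' * (LINT \<tau>:{0<..}|lborel. ?g X Y \<tau>) + p' * P' * (LINT \<tau>:{0<..}|lborel. ?h (X + Y) \<tau>))"
    by (simp only: set_integral_mult_right set_integral_add(2) set_integral_diff(1,2) set_integrable_mult_right int if_True simp_thms)
  finally have eq: "(LINT \<tau>:{0<..}|lborel. of_real (\<tau> powr (- \<beta> - 1)) *
      (laplace_factor p p' q q' \<tau> t * laplace_factor P P' Q Q' \<tau> s)) = \<dots>" .
  have 0: "of_real (\<beta> * (\<beta> - 1)) * (LINT \<tau>:{0<..}|lborel. ?h (X + Y) \<tau>) =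
      of_real (Gamma (2 - \<beta>)) * (b * (b - 1) * (X + Y) powr (b - 2))"
    unfolding power_kernel_0(2)[OF \<beta> XY] b_def by simp
  have 1: "of_real (\<beta> * (\<beta> - 1)) * (LINT \<tau>:{0<..}|lborel. ?g X Y \<tau>) =
      of_real (Gamma (2 - \<beta>)) * (b * ((X + Y) powr (b - 1) - X powr (b - 1)))"
    using power_kernel_1[OF \<beta> X Y] unfolding b_def of_real_mult mult.assoc by (simp only: mult.left_commute)
  have 2: "of_real (\<beta> * (\<beta> - 1)) * (LINT \<tau>:{0<..}|lborel. ?g Y X \<tau>) =
      of_real (Gamma (2 - \<beta>)) * (b * ((X + Y) powr (b - 1) - Y powr (b - 1)))"
    using power_kernel_1[OF \<beta> Y X] unfolding b_def of_real_mult mult.assoc add.commute[of X] by (simp only: mult.left_commute)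
  have 3: "of_real (\<beta> * (\<beta> - 1)) * (LINT \<tau>:{0<..}|lborel. ?f \<tau>) =
      of_real (Gamma (2 - \<beta>)) * power_defect b X Y"
    unfolding power_kernel_2[OF \<beta> X Y] b_def power_defect_def ..
  have "k * (e * (A * I3 - B * I2 - C * I1 + D * I0)) = e * (A * (k * I3) - B * (k * I2) - C * (k * I1) + D * (k * I0))"
    for k e A B C D I0 I1 I2 I3 :: complex by (simp add: algebra_simps)
  note alg = this
  show ?thesis
    unfolding eq alg 0 1 2 3 by (simp add: algebra_simps)
qed


lemma integral_exp_complex:
  fixes c :: complex
  assumes "Re c > 0"
  shows "set_integrable lborel {0<..} (\<lambda>t. exp (- (of_real t * c)))"
    and "(LINT t:{0<..}|lborel. exp (- (of_real t * c))) = 1 / c"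
proof -
  have "c \<noteq> 0" using assms by auto
  have eq: "indicator {0<..} t *\<^sub>R (of_real (t powr (1 - 1)) * exp (- (of_real t * c))) =
      indicator {0<..} t *\<^sub>R exp (- (of_real t * c))" for t
    by (auto simp: indicator_def)
  show "set_integrable lborel {0<..} (\<lambda>t. exp (- (of_real t * c)))"
    and "(LINT t:{0<..}|lborel. exp (- (of_real t * c))) = 1 / c"
    using integral_powr_exp_complex[of 1 c] assms \<open>c \<noteq> 0\<close> unfolding set_integrable_def set_lebesgue_integral_def eq
    by (simp_all add: powr_minus divide_inverse)
qed

section \<open>Integrating out the two time variables\<close>

text \<open>The factor is a combination of the exponentials \<open>exp (- t q)\<close> and \<open>exp (- t (q + \<tau> p))\<close>.\<close>

lemma laplace_factor_integrable:
  assumes "Re p > 0" "Re q > 0" "\<tau> > 0"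
  shows "set_integrable lborel {0<..} (laplace_factor p p' q q' \<tau>)"
    and "(LINT t:{0<..}|lborel. laplace_factor p p' q q' \<tau> t) =
      of_real \<tau> * p' / (q + of_real \<tau> * p) - q' * (1 / q - 1 / (q + of_real \<tau> * p))"
proof -
  have pos: "Re (q + of_real \<tau> * p) > 0" using assms by (simp add: add_pos_pos)
  have eq: "laplace_factor p p' q q' \<tau> = (\<lambda>t. of_real \<tau> * p' * exp (- (of_real t * (q + of_real \<tau> * p)))
      - q' * (exp (- (of_real t * q)) - exp (- (of_real t * (q + of_real \<tau> * p)))))"
  proof
    fix t
    have "exp (- (of_real t * (q + of_real \<tau> * p))) = exp (- (of_real t * q)) * exp (- (of_real \<tau> * (of_real t * p)))"
      by (simp add: exp_add[symmetric] algebra_simps)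
    thus "laplace_factor p p' q q' \<tau> t = of_real \<tau> * p' * exp (- (of_real t * (q + of_real \<tau> * p)))
      - q' * (exp (- (of_real t * q)) - exp (- (of_real t * (q + of_real \<tau> * p))))"
      by (simp add: laplace_factor_def algebra_simps)
  qed
  note int = integral_exp_complex(1)[OF pos] integral_exp_complex(1)[OF assms(2)]
  show "set_integrable lborel {0<..} (laplace_factor p p' q q' \<tau>)"
    unfolding eq by (intro set_integral_diff(1) set_integrable_mult_right int impI)
  show "(LINT t:{0<..}|lborel. laplace_factor p p' q q' \<tau> t) =
      of_real \<tau> * p' / (q + of_real \<tau> * p) - q' * (1 / q - 1 / (q + of_real \<tau> * p))"
    unfolding eq
    by (simp only: set_integral_mult_right set_integral_diff(1,2) set_integrable_mult_right int
        integral_exp_complex(2)[OF pos] integral_exp_complex(2)[OF assms(2)] simp_thms) simp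
qed

text \<open>The gain \<open>\<tau> / (1 + \<tau>)\<close> near \<open>\<tau> = 0\<close> is what makes Fubini's theorem applicable: two such factors
  beat the weight \<open>\<tau> powr (- \<beta> - 1)\<close>.  The summand with \<open>p'\<close> carries an explicit factor \<open>\<tau>\<close>, but
  its decay rate in \<open>t\<close> also grows linearly in \<open>\<tau>\<close>, so its integral stays bounded.\<close>

lemma integral_norm_laplace_factor_le:
  assumes "Re p > 0" "Re q > 0"
  obtains C where "C \<ge> 0"
    "\<And>\<tau>. \<tau> > 0 \<Longrightarrow> (LINT t:{0<..}|lborel. norm (laplace_factor p p' q q' \<tau> t)) \<le> C * (\<tau> / (1 + \<tau>))"
proof -
  define \<delta> where "\<delta> = min (Re p) (Re q)"
  have \<delta>: "\<delta> > 0" "\<delta> \<le> Re p" "\<delta> \<le> Re q" using assms by (auto simp: \<delta>_def)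
  define C where "C = norm p' / \<delta> + norm q' * (2 / \<delta> + norm p / \<delta>\<^sup>2)"
  have e: "set_integrable lborel {0<..} (\<lambda>t::real. exp (- (s * t)))"
      "(LINT t:{0<..}|lborel. exp (- (s * t))) = 1 / s" if "s > 0" for s
  proof -
    have eq: "indicator {0<..} t *\<^sub>R (t powr (1 - 1) * exp (- (s * t))) =
      indicator {0<..} t *\<^sub>R exp (- (s * t))" for t :: real
      by (auto simp: indicator_def)
    show "set_integrable lborel {0<..} (\<lambda>t::real. exp (- (s * t)))"
      "(LINT t:{0<..}|lborel. exp (- (s * t))) = 1 / s"
      using integral_powr_exp[of 1 s] that unfolding set_integrable_def set_lebesgue_integral_def eq
      by (simp_all add: powr_minus divide_inverse)
  qed
  have te: "set_integrable lborel {0<..} (\<lambda>t::real. t * exp (- (s * t)))"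
      "(LINT t:{0<..}|lborel. t * exp (- (s * t))) = 1 / s\<^sup>2" if "s > 0" for s
  proof -
    have eq: "indicator {0<..} t *\<^sub>R (t powr (2 - 1) * exp (- (s * t))) =
      indicator {0<..} t *\<^sub>R (t * exp (- (s * t)))" for t :: real
      by (auto simp: indicator_def)
    show "set_integrable lborel {0<..} (\<lambda>t::real. t * exp (- (s * t)))"
      "(LINT t:{0<..}|lborel. t * exp (- (s * t))) = 1 / s\<^sup>2"
      using integral_powr_exp[of 2 s] that unfolding set_integrable_def set_lebesgue_integral_def eq
      by (simp_all add: powr_minus divide_inverse Gamma_numeral)
  qed
  have "(LINT t:{0<..}|lborel. norm (laplace_factor p p' q q' \<tau> t)) \<le> C * (\<tau> / (1 + \<tau>))" if \<tau>: "\<tau> > 0" for \<tau>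
  proof -
    let ?B = "\<lambda>t. \<tau> * norm p' * exp (- (\<delta> * (1 + \<tau>) * t)) +
      \<tau> / (1 + \<tau>) * norm q' * (2 * exp (- (\<delta> * t)) + norm p * (t * exp (- (\<delta> * t))))"
    have pos: "\<delta> * (1 + \<tau>) > 0" using \<delta>(1) \<tau> by simp
    note int = e(1)[OF pos] e(1)[OF \<delta>(1)] te(1)[OF \<delta>(1)]
    have B: "norm (laplace_factor p p' q q' \<tau> t) \<le> ?B t" if t: "t > 0" for t
    proof -
      let ?X = "of_real t * p"
      have "norm (laplace_factor p p' q q' \<tau> t) \<le> exp (- (t * Re q)) *
          (\<tau> * norm p' * exp (- (\<tau> * (t * Re p))) + norm q' * norm (1 - exp (- (of_real \<tau> * ?X))))"
        unfolding laplace_factor_def norm_mult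
        by (intro mult_mono order_trans[OF norm_triangle_ineq4] add_mono) (use \<tau> in \<open>auto simp: norm_mult\<close>)
      also have "\<dots> \<le> exp (- (\<delta> * t)) *
          (\<tau> * norm p' * exp (- (\<delta> * \<tau> * t)) + norm q' * (\<tau> / (1 + \<tau>) * (2 + norm ?X)))"
      proof (intro mult_mono add_mono norm_one_minus_exp_scaled_le)
        show "exp (- (t * Re q)) \<le> exp (- (\<delta> * t))"
          using \<delta> t by (simp add: mult.commute[of t])
        have "\<delta> * (\<tau> * t) \<le> Re p * (\<tau> * t)" using \<delta> t \<tau> by (intro mult_right_mono) auto
        thus "exp (- (\<tau> * (t * Re p))) \<le> exp (- (\<delta> * \<tau> * t))" by (simp add: mult_ac)
      qed (use \<tau> t assms in \<open>auto intro!: add_nonneg_nonneg mult_nonneg_nonneg\<close>)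
      also have "\<dots> = ?B t"
      proof -
        have "exp (- (\<delta> * (1 + \<tau>) * t)) = exp (- (\<delta> * t)) * exp (- (\<delta> * \<tau> * t))"
          by (simp add: exp_add[symmetric] algebra_simps)
        thus ?thesis using t by (simp add: norm_mult algebra_simps)
      qed
      finally show ?thesis .
    qed
    have Bint: "set_integrable lborel {0<..} ?B"
      by (intro set_integral_add(1) set_integrable_mult_right int impI)
    have "(LINT t:{0<..}|lborel. norm (laplace_factor p p' q q' \<tau> t)) \<le> (LINT t:{0<..}|lborel. ?B t)"
      using B by (intro set_integral_mono set_integrable_norm laplace_factor_integrable(1) Bint assms \<tau>) auto
    also have "\<dots> = \<tau> * norm p' * (1 / (\<delta> * (1 + \<tau>))) + \<tau> / (1 + \<tau>) * norm q' * (2 * (1 / \<delta>) + norm p * (1 / \<delta>\<^sup>2))"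
      by (simp only: set_integral_mult_right set_integral_add(1,2) set_integrable_mult_right int
        e(2)[OF pos] e(2)[OF \<delta>(1)] te(2)[OF \<delta>(1)] simp_thms)
    also have "\<dots> = C * (\<tau> / (1 + \<tau>))"
      unfolding C_def by (simp add: distrib_left distrib_right mult_ac)
    finally show ?thesis .
  qed
  moreover have "C \<ge> 0" unfolding C_def using \<delta> by simp
  ultimately show thesis using that by blast
qed

lemma integrable_tensor_product:
  fixes f g :: "real \<Rightarrow> complex"
  assumes "integrable lborel f" "integrable lborel g"
  shows "integrable lborel (\<lambda>(t, s). f t * g s)"
    and "(\<integral>(t, s). f t * g s \<partial>lborel) = (\<integral>t. f t \<partial>lborel) * (\<integral>s. g s \<partial>lborel)"
proof -
  have [measurable]: "f \<in> borel_measurable borel" "g \<in> borel_measurable borel"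
    using assms by (auto dest: borel_measurable_integrable)
  have "integrable (lborel \<Otimes>\<^sub>M lborel) (\<lambda>(t, s). f t * g s)"
    using assms by (intro lborel_pair.Fubini_integrable) (auto simp: norm_mult)
  thus "integrable lborel (\<lambda>(t, s). f t * g s)" by (simp add: lborel_prod)
  have "(\<integral>(t, s). f t * g s \<partial>(lborel \<Otimes>\<^sub>M lborel)) = (\<integral>t. \<integral>s. f t * g s \<partial>lborel \<partial>lborel)"
    using \<open>integrable (lborel \<Otimes>\<^sub>M lborel) _\<close> by (subst lborel_pair.integral_fst'[symmetric]) auto
  thus "(\<integral>(t, s). f t * g s \<partial>lborel) = (\<integral>t. f t \<partial>lborel) * (\<integral>s. g s \<partial>lborel)"
    by (simp add: lborel_prod)
qed

text \<open>The exchange of the \<open>(t, s)\<close>-integral with the \<open>\<tau>\<close>-integral, after which the former factorises.\<close>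

lemma Fubini_weighted_product:
  fixes w :: "real \<Rightarrow> complex" and f g :: "real \<Rightarrow> real \<Rightarrow> complex"
  assumes [measurable]: "w \<in> borel_measurable borel"
    "(\<lambda>(\<tau>, t). f \<tau> t) \<in> borel_measurable (borel \<Otimes>\<^sub>M borel)"
    "(\<lambda>(\<tau>, t). g \<tau> t) \<in> borel_measurable (borel \<Otimes>\<^sub>M borel)"
    and int: "\<And>\<tau>. integrable lborel (f \<tau>)" "\<And>\<tau>. integrable lborel (g \<tau>)"
    and dom: "integrable lborel (\<lambda>\<tau>. norm (w \<tau>) * ((\<integral>t. norm (f \<tau> t) \<partial>lborel) * (\<integral>s. norm (g \<tau> s) \<partial>lborel)))"
  shows "integrable lborel (\<lambda>(t, s). \<integral>\<tau>. w \<tau> * (f \<tau> t * g \<tau> s) \<partial>lborel)"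
    and "(\<integral>(t, s). \<integral>\<tau>. w \<tau> * (f \<tau> t * g \<tau> s) \<partial>lborel \<partial>lborel) =
      (\<integral>\<tau>. w \<tau> * ((\<integral>t. f \<tau> t \<partial>lborel) * (\<integral>s. g \<tau> s \<partial>lborel)) \<partial>lborel)"
proof -
  let ?\<Phi> = "\<lambda>\<tau> x. w \<tau> * (f \<tau> (fst x) * g \<tau> (snd x))"
  have prod: "integrable lborel (\<lambda>x. f \<tau> (fst x) * g \<tau> (snd x))"
     "(\<integral>x. f \<tau> (fst x) * g \<tau> (snd x) \<partial>lborel) = (\<integral>t. f \<tau> t \<partial>lborel) * (\<integral>s. g \<tau> s \<partial>lborel)" for \<tau>
    using integrable_tensor_product[OF int(1)[of \<tau>] int(2)[of \<tau>]] by (simp_all add: case_prod_unfold)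
  have nprod: "(\<integral>x. norm (f \<tau> (fst x) * g \<tau> (snd x)) \<partial>lborel) =
      (\<integral>t. norm (f \<tau> t) \<partial>lborel) * (\<integral>s. norm (g \<tau> s) \<partial>lborel)" for \<tau>
  proof -
    have "complex_of_real (\<integral>x. norm (f \<tau> (fst x) * g \<tau> (snd x)) \<partial>lborel) =
        (\<integral>x. of_real (norm (f \<tau> (fst x))) * of_real (norm (g \<tau> (snd x))) \<partial>lborel)"
      by (subst integral_complex_of_real[symmetric]) (simp add: norm_mult)
    also have "\<dots> = of_real ((\<integral>t. norm (f \<tau> t) \<partial>lborel) * (\<integral>s. norm (g \<tau> s) \<partial>lborel))"
      using integrable_tensor_product(2)[of "\<lambda>t. of_real (norm (f \<tau> t))" "\<lambda>t. of_real (norm (g \<tau> t))"] int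
      by (simp add: case_prod_unfold integrable_of_real)
    finally show ?thesis by (simp only: of_real_eq_iff)
  qed
  have "integrable (lborel \<Otimes>\<^sub>M lborel) (\<lambda>(\<tau>, x). ?\<Phi> \<tau> x)"
  proof (rule lborel_pair.Fubini_integrable)
    show "(\<lambda>(\<tau>, x). ?\<Phi> \<tau> x) \<in> borel_measurable (lborel \<Otimes>\<^sub>M (lborel :: (real \<times> real) measure))"
      unfolding lborel_prod[symmetric] by measurable
    show "integrable lborel (\<lambda>\<tau>. \<integral>x. norm (case (\<tau>, x) of (\<tau>, x) \<Rightarrow> ?\<Phi> \<tau> x) \<partial>lborel)"
      using dom by (simp add: norm_mult[of "w _"] nprod)
    show "AE \<tau> in lborel. integrable lborel (\<lambda>x. case (\<tau>, x) of (\<tau>, x) \<Rightarrow> ?\<Phi> \<tau> x)"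
      using prod(1) by simp
  qed
  hence \<Phi>: "integrable (lborel \<Otimes>\<^sub>M lborel) (case_prod ?\<Phi>)" .
  show "integrable lborel (\<lambda>(t, s). \<integral>\<tau>. w \<tau> * (f \<tau> t * g \<tau> s) \<partial>lborel)"
    using lborel_pair.integrable_snd[OF \<Phi>] by (simp add: case_prod_unfold)
  show "(\<integral>(t, s). \<integral>\<tau>. w \<tau> * (f \<tau> t * g \<tau> s) \<partial>lborel \<partial>lborel) =
      (\<integral>\<tau>. w \<tau> * ((\<integral>t. f \<tau> t \<partial>lborel) * (\<integral>s. g \<tau> s \<partial>lborel)) \<partial>lborel)"
    using lborel_pair.Fubini_integral[OF \<Phi>] by (simp add: case_prod_unfold prod)
qed

section \<open>The remaining one-dimensional integral\<close>

definition pair_kernel :: "real \<Rightarrow> complex \<Rightarrow> complex \<Rightarrow> complex" where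
  "pair_kernel \<beta> u v = (LINT \<tau>:{0<..}|lborel. of_real (\<tau> powr (1 - \<beta>)) / ((1 + of_real \<tau> * u) * (1 + of_real \<tau> * v)))"

text \<open>Holomorphy makes the kernel continuous in its second argument, which is how the limit on the
  diagonal is taken.\<close>

lemma pair_kernel_holomorphic:
  assumes "1 < \<beta>" "\<beta> < 2" "u \<notin> \<real>\<^sub>\<le>\<^sub>0"
  shows "pair_kernel \<beta> u holomorphic_on (- \<real>\<^sub>\<le>\<^sub>0)"
proof -
  obtain \<delta> where \<delta>: "\<delta> > 0" "\<And>t. t \<ge> 0 \<Longrightarrow> norm (1 + of_real t * u) \<ge> \<delta> * (1 + t)"
    using slit_plane_denominator_bound[OF assms(3)] by (metis centre_in_ball)
  have "norm (complex_of_real (t powr (1 - \<beta>)) / (1 + of_real t * u)) \<le> 1 / \<delta> * t powr ((2 - \<beta>) - 1)" if "t > 0" for t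
  proof -
    have "\<delta> \<le> \<delta> * (1 + t)" using \<delta>(1) that by (simp add: distrib_left)
    also have "\<dots> \<le> norm (1 + of_real t * u)" using \<delta>(2) that by simp
    finally have "t powr (1 - \<beta>) / norm (1 + of_real t * u) \<le> t powr (1 - \<beta>) / \<delta>"
      using \<delta>(1) by (intro frac_le) auto
    thus ?thesis by (simp add: norm_divide)
  qed
  from holomorphic_powr_div_integral(1)[OF _ _ _ this] assms(1,2)
  show ?thesis unfolding pair_kernel_def[abs_def] by simp
qed

text \<open>Partial fractions: \<open>(u - v) / ((1 + \<tau> u) (1 + \<tau> v)) = u / (1 + \<tau> u) - v / (1 + \<tau> v)\<close>.\<close>

lemma pair_kernel_eq:
  assumes "1 < \<beta>" "\<beta> < 2" "u \<notin> \<real>\<^sub>\<le>\<^sub>0" "v \<notin> \<real>\<^sub>\<le>\<^sub>0" "u \<noteq> v"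
  shows "pair_kernel \<beta> u v = of_real (Gamma (2 - \<beta>) * Gamma (\<beta> - 1)) *
    ((u powr of_real (\<beta> - 1) - v powr of_real (\<beta> - 1)) / (u - v))"
proof -
  let ?f = "\<lambda>u \<tau>. of_real (\<tau> powr (1 - \<beta>)) / (1 + of_real \<tau> * u)"
  have int: "set_integrable lborel {0<..} (?f u)" if "u \<notin> \<real>\<^sub>\<le>\<^sub>0" for u :: complex
    by (rule holomorphic_powr_div_integral(2)[where a = "2 - \<beta>" and C = 1]) (use assms that in auto)
  have val: "u * (LINT \<tau>:{0<..}|lborel. ?f u \<tau>) = of_real (Gamma (2 - \<beta>) * Gamma (\<beta> - 1)) * u powr of_real (\<beta> - 1)"
    if "u \<notin> \<real>\<^sub>\<le>\<^sub>0" for u :: complex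
  proof -
    have "u \<noteq> 0" using that by auto
    hence "u * u powr (- of_real (2 - \<beta>)) = u powr of_real (\<beta> - 1)"
      using powr_add[of u 1 "- of_real (2 - \<beta>)"] by simp
    thus ?thesis using integral_powr_div_complex[of "2 - \<beta>" u] assms that
      by (simp add: mult.left_commute)
  qed
  have nz: "1 + of_real \<tau> * u \<noteq> 0" if u: "u \<notin> \<real>\<^sub>\<le>\<^sub>0" and \<tau>: "\<tau> > 0" for u :: complex and \<tau> :: real
  proof -
    obtain \<delta> where \<delta>: "\<delta> > 0" "\<And>t. t \<ge> 0 \<Longrightarrow> norm (1 + of_real t * u) \<ge> \<delta> * (1 + t)"
      using slit_plane_denominator_bound[OF u] by (metis centre_in_ball)
    have "0 < \<delta> * (1 + \<tau>)" using \<delta>(1) \<tau> by simp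
    also have "\<dots> \<le> norm (1 + of_real \<tau> * u)" using \<delta>(2) \<tau> by simp
    finally show ?thesis by auto
  qed
  have "(u - v) * pair_kernel \<beta> u v = (LINT \<tau>:{0<..}|lborel. u * ?f u \<tau> - v * ?f v \<tau>)"
    unfolding pair_kernel_def set_integral_mult_right[symmetric]
  proof (intro set_lebesgue_integral_cong allI impI)
    fix \<tau> :: real assume "\<tau> \<in> {0<..}"
    hence "1 + of_real \<tau> * u \<noteq> 0" "1 + of_real \<tau> * v \<noteq> 0"
      using nz assms by auto
    thus "(u - v) * (of_real (\<tau> powr (1 - \<beta>)) / ((1 + of_real \<tau> * u) * (1 + of_real \<tau> * v))) =
        u * ?f u \<tau> - v * ?f v \<tau>"
      by (simp add: divide_simps) (simp add: algebra_simps)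
  qed auto
  also have "\<dots> = of_real (Gamma (2 - \<beta>) * Gamma (\<beta> - 1)) * (u powr of_real (\<beta> - 1) - v powr of_real (\<beta> - 1))"
    using assms(3,4)
    by (simp only: set_integral_diff(2) set_integral_mult_right set_integrable_mult_right int val right_diff_distrib simp_thms)
  finally show ?thesis using assms(5) by (simp add: field_simps)
qed

section \<open>The covariance kernel\<close>

text \<open>The name refers to the identity \<open>mp_ratio = mp_slope / mp_decay\<close> for \<open>\<sigma> = sgn (Im z)\<close>, which is
  the Marchenko--Pastur equation in disguise.\<close>

definition mp_ratio :: "real \<Rightarrow> complex \<Rightarrow> complex" where
  "mp_ratio y z = 1 - z * mp_stieltjes y z"

text \<open>The argument \<open>\<sigma>\<close> stands for the sign of \<open>Im z\<close>.  Keeping it fixed makes the function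
  holomorphic, while \<open>K(z,t) = t * mp_slope y \<sigma> z\<close> on the half plane with that sign.\<close>

definition mp_slope :: "real \<Rightarrow> real \<Rightarrow> complex \<Rightarrow> complex" where
  "mp_slope y \<sigma> z = \<i> * of_real \<sigma> * (z * mp_stieltjes y z)"

definition mp_decay :: "real \<Rightarrow> real \<Rightarrow> complex \<Rightarrow> complex" where
  "mp_decay y \<sigma> z = of_real y * mp_slope y \<sigma> z - \<i> * of_real \<sigma> * z"

text \<open>The real parts are positive because \<open>Im u\<close> has the sign of \<open>Im z\<close>; the third claim is the
  quadratic equation, up to the factor \<open>- \<i> \<sigma>\<close>.\<close>

lemma mp_ratio_properties:
  assumes "y > 0" "z \<notin> \<real>" and \<sigma>: "\<sigma> = sgn (Im z)"
  shows "Re (mp_slope y \<sigma> z) > 0" "Re (mp_decay y \<sigma> z) > 0"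
    and "mp_slope y \<sigma> z = mp_decay y \<sigma> z * mp_ratio y z"
    and "mp_ratio y z \<notin> \<real>\<^sub>\<le>\<^sub>0"
proof -
  have quad: "of_real y * (mp_ratio y z)\<^sup>2 + (z - 1 - of_real y) * mp_ratio y z + 1 = 0"
    and im: "Im z * Im (mp_ratio y z) > 0"
    using mp_stieltjes_quadratic[OF assms(1,2)] unfolding mp_ratio_def by auto
  have slope: "mp_slope y \<sigma> z = \<i> * of_real \<sigma> * (1 - mp_ratio y z)"
    by (simp add: mp_slope_def mp_ratio_def)
  show pos: "Re (mp_slope y \<sigma> z) > 0"
  proof -
    have "Re (mp_slope y \<sigma> z) = \<sigma> * Im (mp_ratio y z)" unfolding slope by simp
    thus ?thesis using im unfolding \<sigma> by (auto simp: sgn_if zero_less_mult_iff)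
  qed
  have "\<sigma> * Im z > 0" using im unfolding \<sigma> by (auto simp: sgn_if zero_less_mult_iff)
  thus "Re (mp_decay y \<sigma> z) > 0"
    using pos assms(1) by (simp add: mp_decay_def add_pos_pos)
  show "mp_ratio y z \<notin> \<real>\<^sub>\<le>\<^sub>0" using im by (auto simp: complex_nonpos_Reals_iff)
  have "mp_decay y \<sigma> z * mp_ratio y z = - (\<i> * of_real \<sigma>) * (of_real y * (mp_ratio y z)\<^sup>2 + (z - 1 - of_real y) * mp_ratio y z + 1)
      - (\<i> * of_real \<sigma>) * (mp_ratio y z - 1)"
    unfolding mp_decay_def slope by (simp add: algebra_simps power2_eq_square)
  thus "mp_slope y \<sigma> z = mp_decay y \<sigma> z * mp_ratio y z"
    unfolding quad slope by (simp add: algebra_simps)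
qed

text \<open>The quadratic equation is linear in \<open>z\<close> with coefficient \<open>u \<noteq> 0\<close>, so \<open>u\<close> determines \<open>z\<close>.\<close>

lemma mp_ratio_inj:
  assumes "y > 0" "z \<notin> \<real>" "w \<notin> \<real>" "mp_ratio y z = mp_ratio y w"
  shows "z = w"
proof -
  have eq: "of_real y * (mp_ratio y z)\<^sup>2 + (v - 1 - of_real y) * mp_ratio y z + 1 = 0" if "v \<in> {z, w}" for v
    using mp_stieltjes_quadratic(1)[OF assms(1), of v] that assms(2-4) unfolding mp_ratio_def[symmetric] by auto
  have "mp_ratio y z \<noteq> 0" using mp_ratio_properties(4)[OF assms(1,2) refl] by auto
  moreover have "(z - w) * mp_ratio y z = (of_real y * (mp_ratio y z)\<^sup>2 + (z - 1 - of_real y) * mp_ratio y z + 1) -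
      (of_real y * (mp_ratio y z)\<^sup>2 + (w - 1 - of_real y) * mp_ratio y z + 1)"
    by (simp add: algebra_simps)
  hence "(z - w) * mp_ratio y z = 0" using eq[of z] eq[of w] by simp
  ultimately show ?thesis by simp
qed

lemma open_same_sign_half_plane: "open {v. sgn (Im v) = sgn (Im z)}" if "z \<notin> \<real>"
proof -
  have "{v. sgn (Im v) = sgn (Im z)} = (if Im z > 0 then {v. Im v > 0} else {v. Im v < 0})"
    using that by (auto simp: complex_is_Real_iff sgn_if split: if_splits)
  thus ?thesis by (simp add: open_halfspace_Im_gt open_halfspace_Im_lt)
qed

lemma eventually_same_sign:
  assumes "z \<notin> \<real>"
  shows "\<forall>\<^sub>F v in nhds z. sgn (Im v) = sgn (Im z)"
  using eventually_nhds_in_open[OF open_same_sign_half_plane[OF assms], of z] by simp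

lemma z_mp_stieltjes_holomorphic:
  assumes "y > 0"
  shows "(\<lambda>z. z * mp_stieltjes y z) holomorphic_on (- \<real>)"
  using mp_stieltjes_holomorphic[OF assms] by (intro holomorphic_intros)

lemma mp_derivatives:
  assumes "y > 0" "z \<notin> \<real>"
  defines "g' \<equiv> deriv (\<lambda>z. z * mp_stieltjes y z) z"
  shows "(mp_slope y \<sigma> has_field_derivative \<i> * of_real \<sigma> * g') (at z)"
    and "(mp_decay y \<sigma> has_field_derivative of_real y * (\<i> * of_real \<sigma> * g') - \<i> * of_real \<sigma>) (at z)"
    and "(mp_ratio y has_field_derivative - g') (at z)"
proof -
  have g: "((\<lambda>z. z * mp_stieltjes y z) has_field_derivative g') (at z)"
    unfolding g'_def using assms(2) closed_complex_Reals
    by (intro holomorphic_derivI[OF z_mp_stieltjes_holomorphic[OF assms(1)]]) auto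
  show s: "(mp_slope y \<sigma> has_field_derivative \<i> * of_real \<sigma> * g') (at z)"
    unfolding mp_slope_def[abs_def] by (rule DERIV_cmult[OF g])
  show "(mp_decay y \<sigma> has_field_derivative of_real y * (\<i> * of_real \<sigma> * g') - \<i> * of_real \<sigma>) (at z)"
    unfolding mp_decay_def[abs_def]
    using DERIV_diff[OF DERIV_cmult[OF s] DERIV_cmult[OF DERIV_ident]] by simp
  show "(mp_ratio y has_field_derivative - g') (at z)"
    unfolding mp_ratio_def[abs_def] using DERIV_diff[OF DERIV_const g] by simp
qed

lemma kern_L_eq:
  assumes "sgn (Im v) = \<sigma>" "sgn (Im v') = \<sigma>'"
  shows "kern_L \<alpha> c y v t v' s = of_real (y * c) / of_real (t * s) *
    exp (- (of_real t * mp_decay y \<sigma> v + of_real s * mp_decay y \<sigma>' v')) *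
    power_defect (of_real (\<alpha> / 2)) (of_real t * mp_slope y \<sigma> v) (of_real s * mp_slope y \<sigma>' v')"
proof -
  have K: "kern_K y v t = of_real t * mp_slope y \<sigma> v" "kern_K y v' s = of_real s * mp_slope y \<sigma>' v'"
    using assms by (simp_all add: kern_K_def mp_slope_def mult_ac)
  have e: "exp (- (of_real t * mp_decay y \<sigma> v + of_real s * mp_decay y \<sigma>' v')) =
    exp (\<i> * of_real \<sigma> * of_real t * v + \<i> * of_real \<sigma>' * of_real s * v') *
    exp (- of_real y * (of_real t * mp_slope y \<sigma> v) - of_real y * (of_real s * mp_slope y \<sigma>' v'))"
    unfolding exp_add[symmetric] by (simp add: mp_decay_def algebra_simps)
  show ?thesis
    unfolding kern_L_def kern_l_def kern_r_def K e assms power_defect_def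
    by simp
qed

text \<open>Differentiating \<open>p = q u\<close> gives \<open>p' - q' u = q u'\<close>, and with \<open>q + \<tau> p = q (1 + \<tau> u)\<close> all terms
  except \<open>\<tau> u' / (1 + \<tau> u)\<close> cancel.  The derivative of \<open>u\<close> is \<open>- g'\<close>.\<close>

lemma integral_laplace_factor_mp:
  assumes "y > 0" "z \<notin> \<real>" "\<tau> > 0"
  defines "\<sigma> \<equiv> sgn (Im z)" and "g' \<equiv> deriv (\<lambda>z. z * mp_stieltjes y z) z"
  shows "(LINT t:{0<..}|lborel. laplace_factor (mp_slope y \<sigma> z) (\<i> * of_real \<sigma> * g') (mp_decay y \<sigma> z)
      (of_real y * (\<i> * of_real \<sigma> * g') - \<i> * of_real \<sigma>) \<tau> t) = - g' * (of_real \<tau> / (1 + of_real \<tau> * mp_ratio y z))"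
proof -
  define p q p' q' u where defs: "p = mp_slope y \<sigma> z" "q = mp_decay y \<sigma> z" "p' = \<i> * of_real \<sigma> * g'"
    "q' = of_real y * (\<i> * of_real \<sigma> * g') - \<i> * of_real \<sigma>" "u = mp_ratio y z"
  note sd = mp_ratio_properties[OF assms(1,2) refl, folded \<sigma>_def, folded defs]
  note der = mp_derivatives(1,2)[OF assms(1,2), of \<sigma>, folded g'_def, folded defs(3,4)]
    mp_derivatives(3)[OF assms(1,2), folded g'_def]
  have ev: "\<forall>\<^sub>F v in nhds z. mp_slope y \<sigma> v = mp_decay y \<sigma> v * mp_ratio y v"
  proof -
    have "\<forall>\<^sub>F v in nhds z. v \<in> - \<real>"
      using assms(2) closed_complex_Reals by (intro eventually_nhds_in_open) auto
    with eventually_same_sign[OF assms(2)] show ?thesis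
      by eventually_elim (rule mp_ratio_properties(3)[OF assms(1)], auto simp: \<sigma>_def)
  qed
  have "((\<lambda>v. mp_decay y \<sigma> v * mp_ratio y v) has_field_derivative p') (at z)"
    by (rule iffD1[OF DERIV_cong_ev[OF refl ev refl] der(1)])
  moreover have "((\<lambda>v. mp_decay y \<sigma> v * mp_ratio y v) has_field_derivative q' * u + - g' * q) (at z)"
    using DERIV_mult[OF der(2,3)] by (simp add: defs)
  ultimately have p': "p' = q' * u + - g' * q" by (rule DERIV_unique)
  have q0: "q \<noteq> 0" using sd(2) by auto
  have pos: "Re (q + of_real \<tau> * p) > 0" using sd assms(3) by (simp add: add_pos_pos)
  have D: "q + of_real \<tau> * p = q * (1 + of_real \<tau> * u)" unfolding sd(3) by (simp add: algebra_simps)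
  have "q + of_real \<tau> * p \<noteq> 0" using pos by (metis less_irrefl zero_complex.sel(1))
  hence D0: "1 + of_real \<tau> * u \<noteq> 0" unfolding D by simp
  have "(LINT t:{0<..}|lborel. laplace_factor p p' q q' \<tau> t) =
      of_real \<tau> * p' / (q + of_real \<tau> * p) - q' * (1 / q - 1 / (q + of_real \<tau> * p))"
    by (rule laplace_factor_integrable(2)) (use sd assms(3) in auto)
  also have "\<dots> = - g' * (of_real \<tau> / (1 + of_real \<tau> * u))"
    unfolding D p' using q0 D0 by (simp add: divide_simps) (simp add: algebra_simps)
  finally show ?thesis unfolding defs .
qed

text \<open>This formula has no singularity on the diagonal, so it serves both for \<open>z \<noteq> w\<close> and for the
  limit.\<close>

lemma cov_kernel_eq:
  fixes \<alpha> c y :: real and z w :: complex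
  assumes \<alpha>: "2 < \<alpha>" "\<alpha> < 4" and y: "y > 0" and z: "z \<notin> \<real>" and w: "w \<notin> \<real>"
  defines "\<beta> \<equiv> \<alpha> / 2"
  shows "set_integrable lborel ({0<..} \<times> {0<..}) (cov_integrand \<alpha> c y z w)"
    and "cov_kernel \<alpha> c y z w = of_real (y * c * (\<beta> * (\<beta> - 1)) / Gamma (2 - \<beta>)) *
      (deriv (\<lambda>z. z * mp_stieltjes y z) z * deriv (\<lambda>z. z * mp_stieltjes y z) w *
       pair_kernel \<beta> (mp_ratio y z) (mp_ratio y w))"
proof -
  have \<beta>: "1 < \<beta>" "\<beta> < 2" using \<alpha> by (auto simp: \<beta>_def)
  define \<sigma> \<sigma>' where \<sigma>: "\<sigma> = sgn (Im z)" "\<sigma>' = sgn (Im w)"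
  define g' h' where g': "g' = deriv (\<lambda>z. z * mp_stieltjes y z) z" "h' = deriv (\<lambda>z. z * mp_stieltjes y z) w"
  define p q p' q' where p: "p = mp_slope y \<sigma> z" "q = mp_decay y \<sigma> z" "p' = \<i> * of_real \<sigma> * g'"
    "q' = of_real y * (\<i> * of_real \<sigma> * g') - \<i> * of_real \<sigma>"
  define P Q P' Q' where P: "P = mp_slope y \<sigma>' w" "Q = mp_decay y \<sigma>' w" "P' = \<i> * of_real \<sigma>' * h'"
    "Q' = of_real y * (\<i> * of_real \<sigma>' * h') - \<i> * of_real \<sigma>'"
  define k where "k = complex_of_real (y * c * (\<beta> * (\<beta> - 1)) / Gamma (2 - \<beta>))"
  have G: "Gamma (2 - \<beta>) > 0" using \<beta> by (intro Gamma_real_pos) auto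
  note posz = mp_ratio_properties[OF y z \<sigma>(1), folded p] and posw = mp_ratio_properties[OF y w \<sigma>(2), folded P]
  note derz = mp_derivatives(1,2)[OF y z, of \<sigma>, folded g', folded p(3,4)]
    and derw = mp_derivatives(1,2)[OF y w, of \<sigma>', folded g', folded P(3,4)]
  let ?W = "\<lambda>\<tau>. indicator {0<..} \<tau> *\<^sub>R complex_of_real (\<tau> powr (- \<beta> - 1))"
  let ?f = "\<lambda>\<tau> t. (indicator {0<..} \<tau> * indicator {0<..} t) *\<^sub>R laplace_factor p p' q q' \<tau> t"
  let ?g = "\<lambda>\<tau> s. (indicator {0<..} \<tau> * indicator {0<..} s) *\<^sub>R laplace_factor P P' Q Q' \<tau> s"
  \<comment> \<open>The sign of the imaginary part is locally constant, so near \<open>z\<close> and \<open>w\<close> the kernel coincides with a holomorphic expression, which is all that the derivatives see.\<close>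
  have integrand: "cov_integrand \<alpha> c y z w (t, s) =
      k * (LINT \<tau>:{0<..}|lborel. of_real (\<tau> powr (- \<beta> - 1)) * (laplace_factor p p' q q' \<tau> t * laplace_factor P P' Q Q' \<tau> s))"
    if ts: "t > 0" "s > 0" for t s
  proof -
    let ?L = "\<lambda>v v'. of_real (y * c) / of_real (t * s) *
      exp (- (of_real t * mp_decay y \<sigma> v + of_real s * mp_decay y \<sigma>' v')) *
      power_defect (of_real \<beta>) (of_real t * mp_slope y \<sigma> v) (of_real s * mp_slope y \<sigma>' v')"
    have inner: "deriv (\<lambda>v'. kern_L \<alpha> c y v t v' s) w = deriv (?L v) w" if "sgn (Im v) = \<sigma>" for v
      by (intro deriv_cong_ev refl eventually_mono[OF eventually_same_sign[OF w]])
         (use that in \<open>auto simp: kern_L_eq \<sigma> \<beta>_def\<close>)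
    have "cov_integrand \<alpha> c y z w (t, s) = deriv (\<lambda>v. deriv (?L v) w) z"
      unfolding cov_integrand_def prod.case
      by (rule deriv_cong_ev[OF eventually_mono[OF eventually_same_sign[OF z]] refl], rule inner)
         (simp add: \<sigma>)
    also have "\<dots> = of_real (y * c) * (exp (- (of_real t * q + of_real s * Q)) *
      (q' * Q' * power_defect (of_real \<beta>) (of_real t * p) (of_real s * P)
       - q' * P' * (of_real \<beta> * ((of_real t * p + of_real s * P) powr (of_real \<beta> - 1) - (of_real s * P) powr (of_real \<beta> - 1)))
       - Q' * p' * (of_real \<beta> * ((of_real t * p + of_real s * P) powr (of_real \<beta> - 1) - (of_real t * p) powr (of_real \<beta> - 1)))
       + p' * P' * (of_real \<beta> * (of_real \<beta> - 1) * (of_real t * p + of_real s * P) powr (of_real \<beta> - 2))))"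
    proof -
      have "\<forall>\<^sub>F v in nhds z. v \<in> - \<real>"
        using z closed_complex_Reals by (intro eventually_nhds_in_open) auto
      with eventually_same_sign[OF z] have "\<forall>\<^sub>F v in nhds z. Re (mp_slope y \<sigma> v) > 0"
        by eventually_elim (rule mp_ratio_properties(1)[OF y], auto simp: \<sigma>)
      from mixed_derivative_power_defect[OF ts derz(1,2) _ derw(1,2) _ this, of "of_real (y * c)" "of_real \<beta>"]
      show ?thesis using posz(1) posw(1) unfolding p(1,2) P(1,2) by (simp only: mult.assoc)
    qed
    also have "\<dots> = of_real (y * c) * (of_real (\<beta> * (\<beta> - 1) / Gamma (2 - \<beta>)) *
        (LINT \<tau>:{0<..}|lborel. of_real (\<tau> powr (- \<beta> - 1)) * (laplace_factor p p' q q' \<tau> t * laplace_factor P P' Q Q' \<tau> s)))"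
    proof -
      have solve: "E = of_real (a / d) * I" if "of_real a * I = of_real d * E" "d \<noteq> 0" for E I :: complex and a d
        using that by (simp add: field_simps)
      show ?thesis
        by (rule arg_cong[where f = "\<lambda>x. of_real (y * c) * x"],
            rule solve[OF laplace_factor_integral_representation[OF \<beta> ts posz(1) posw(1)]])
           (use G in simp)
    qed
    finally show ?thesis by (simp add: k_def mult.assoc)
  qed
  have ind: "indicator ({0<..} \<times> {0<..}) x *\<^sub>R cov_integrand \<alpha> c y z w x =
      k * (case x of (t, s) \<Rightarrow> \<integral>\<tau>. ?W \<tau> * (?f \<tau> t * ?g \<tau> s) \<partial>lborel)" for x
  proof (cases "x \<in> {0<..} \<times> {0<..}")
    case True
    then obtain t s where x: "x = (t, s)" "t > 0" "s > 0" by auto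
    have "(\<integral>\<tau>. ?W \<tau> * (?f \<tau> t * ?g \<tau> s) \<partial>lborel) =
        (LINT \<tau>:{0<..}|lborel. of_real (\<tau> powr (- \<beta> - 1)) * (laplace_factor p p' q q' \<tau> t * laplace_factor P P' Q Q' \<tau> s))"
      unfolding set_lebesgue_integral_def using x
      by (intro Bochner_Integration.integral_cong) (auto simp: indicator_def)
    thus ?thesis using integrand[OF x(2,3)] x by simp
  next
    case False
    then obtain t s where x: "x = (t, s)" "\<not> t > 0 \<or> \<not> s > 0" by (cases x) auto
    hence "(\<lambda>\<tau>. ?W \<tau> * (?f \<tau> t * ?g \<tau> s)) = (\<lambda>_. 0)" by (auto simp: fun_eq_iff indicator_def)
    thus ?thesis using False x by simp
  qed
  have fint: "integrable lborel (?f \<tau>) \<and> integrable lborel (?g \<tau>)" for \<tau>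
  proof (cases "\<tau> > 0")
    case True
    thus ?thesis
      using laplace_factor_integrable(1)[OF posz(1,2) True, of p' q'] laplace_factor_integrable(1)[OF posw(1,2) True, of P' Q']
      by (simp add: set_integrable_def)
  qed auto
  obtain C where C: "C \<ge> 0" "\<And>\<tau>. \<tau> > 0 \<Longrightarrow> (LINT t:{0<..}|lborel. norm (laplace_factor p p' q q' \<tau> t)) \<le> C * (\<tau> / (1 + \<tau>))"
    using integral_norm_laplace_factor_le[OF posz(1,2)] by blast
  obtain D where D: "D \<ge> 0" "\<And>\<tau>. \<tau> > 0 \<Longrightarrow> (LINT t:{0<..}|lborel. norm (laplace_factor P P' Q Q' \<tau> t)) \<le> D * (\<tau> / (1 + \<tau>))"
    using integral_norm_laplace_factor_le[OF posw(1,2)] by blast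
  have dom: "integrable lborel (\<lambda>\<tau>. norm (?W \<tau>) * ((\<integral>t. norm (?f \<tau> t) \<partial>lborel) * (\<integral>s. norm (?g \<tau> s) \<partial>lborel)))"
  proof (rule Bochner_Integration.integrable_bound)
    show "integrable lborel (\<lambda>\<tau>. (C * D) * (indicator {0<..} \<tau> *\<^sub>R (\<tau> powr ((2 - \<beta>) - 1) / (1 + \<tau>))))"
      using set_integrable_powr_div[of "2 - \<beta>"] \<beta> unfolding set_integrable_def by (intro integrable_mult_right) auto
    show "AE \<tau> in lborel. norm (norm (?W \<tau>) * ((\<integral>t. norm (?f \<tau> t) \<partial>lborel) * (\<integral>s. norm (?g \<tau> s) \<partial>lborel)))
        \<le> norm ((C * D) * (indicator {0<..} \<tau> *\<^sub>R (\<tau> powr ((2 - \<beta>) - 1) / (1 + \<tau>))))"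
    proof (rule AE_I2)
      fix \<tau> :: real
      show "norm (norm (?W \<tau>) * ((\<integral>t. norm (?f \<tau> t) \<partial>lborel) * (\<integral>s. norm (?g \<tau> s) \<partial>lborel)))
        \<le> norm ((C * D) * (indicator {0<..} \<tau> *\<^sub>R (\<tau> powr ((2 - \<beta>) - 1) / (1 + \<tau>))))"
      proof (cases "\<tau> > 0")
        case True
        have f: "(\<integral>t. norm (?f \<tau> t) \<partial>lborel) \<le> C * (\<tau> / (1 + \<tau>))"
          using C(2)[OF True] True by (simp add: set_lebesgue_integral_def)
        have g: "(\<integral>t. norm (?g \<tau> t) \<partial>lborel) \<le> D * (\<tau> / (1 + \<tau>))"
          using D(2)[OF True] True by (simp add: set_lebesgue_integral_def)
        \<comment> \<open>One of the two factors \<open>\<tau> / (1 + \<tau>)\<close> is enough at infinity; the other may be replaced by \<open>\<tau>\<close>.\<close>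
        have "\<tau> / (1 + \<tau>) \<le> \<tau>" using True by (simp add: field_simps)
        hence g': "(\<integral>t. norm (?g \<tau> t) \<partial>lborel) \<le> D * \<tau>"
          using g D(1) mult_left_mono order_trans by blast
        have "norm (norm (?W \<tau>) * ((\<integral>t. norm (?f \<tau> t) \<partial>lborel) * (\<integral>s. norm (?g \<tau> s) \<partial>lborel))) =
            \<tau> powr (- \<beta> - 1) * ((\<integral>t. norm (?f \<tau> t) \<partial>lborel) * (\<integral>s. norm (?g \<tau> s) \<partial>lborel))"
          using True by (simp add: abs_mult)
        also have "\<dots> \<le> \<tau> powr (- \<beta> - 1) * ((C * (\<tau> / (1 + \<tau>))) * (D * \<tau>))"
          using f g' C(1) True by (intro mult_left_mono mult_mono) auto
        also have "\<dots> = (C * D) * ((\<tau> powr (- \<beta> - 1) * \<tau>\<^sup>2) / (1 + \<tau>))"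
          by (simp add: power2_eq_square)
        also have "\<tau> powr (- \<beta> - 1) * \<tau>\<^sup>2 = \<tau> powr ((2 - \<beta>) - 1)"
          using True by (simp add: powr_add[symmetric] flip: powr_numeral)
        finally show ?thesis using True C(1) D(1) by (simp add: abs_mult)
      qed simp
    qed
  qed (measurable; simp)
  note Fub = Fubini_weighted_product[of ?W ?f ?g, OF _ _ _ fint[THEN conjunct1] fint[THEN conjunct2] dom]
  have meas: "(\<lambda>(\<tau>, t). ?f \<tau> t) \<in> borel_measurable (borel \<Otimes>\<^sub>M borel)"
    "(\<lambda>(\<tau>, t). ?g \<tau> t) \<in> borel_measurable (borel \<Otimes>\<^sub>M borel)" "?W \<in> borel_measurable borel"
    by measurable
  show "set_integrable lborel ({0<..} \<times> {0<..}) (cov_integrand \<alpha> c y z w)"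
    unfolding set_integrable_def ind using Fub(1)[OF meas(3,1,2)] by (intro integrable_mult_right) auto
  have "cov_kernel \<alpha> c y z w = k * (\<integral>\<tau>. ?W \<tau> * ((\<integral>t. ?f \<tau> t \<partial>lborel) * (\<integral>s. ?g \<tau> s \<partial>lborel)) \<partial>lborel)"
    unfolding cov_kernel_def set_lebesgue_integral_def ind
    by (subst integral_mult_right_zero) (simp only: Fub(2)[OF meas(3,1,2)])
  also have "(\<integral>\<tau>. ?W \<tau> * ((\<integral>t. ?f \<tau> t \<partial>lborel) * (\<integral>s. ?g \<tau> s \<partial>lborel)) \<partial>lborel) =
      (LINT \<tau>:{0<..}|lborel. (g' * h') * (of_real (\<tau> powr (1 - \<beta>)) / ((1 + of_real \<tau> * mp_ratio y z) * (1 + of_real \<tau> * mp_ratio y w))))"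
    unfolding set_lebesgue_integral_def
  proof (rule Bochner_Integration.integral_cong[OF refl])
    fix \<tau> :: real
    show "?W \<tau> * ((\<integral>t. ?f \<tau> t \<partial>lborel) * (\<integral>s. ?g \<tau> s \<partial>lborel)) =
       indicator {0<..} \<tau> *\<^sub>R ((g' * h') * (of_real (\<tau> powr (1 - \<beta>)) / ((1 + of_real \<tau> * mp_ratio y z) * (1 + of_real \<tau> * mp_ratio y w))))"
    proof (cases "\<tau> > 0")
      case True
      have f: "(\<integral>t. ?f \<tau> t \<partial>lborel) = - g' * (of_real \<tau> / (1 + of_real \<tau> * mp_ratio y z))"
        using integral_laplace_factor_mp[OF y z True, folded \<sigma> g', folded p] True
        by (simp add: set_lebesgue_integral_def)
      have g: "(\<integral>t. ?g \<tau> t \<partial>lborel) = - h' * (of_real \<tau> / (1 + of_real \<tau> * mp_ratio y w))"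
        using integral_laplace_factor_mp[OF y w True, folded \<sigma> g', folded P] True
        by (simp add: set_lebesgue_integral_def)
      have "\<tau> powr (1 - \<beta>) = \<tau> powr (- \<beta> - 1) * \<tau> * \<tau>"
        using True by (simp add: powr_diff powr_minus field_simps)
      hence W: "complex_of_real (\<tau> powr (1 - \<beta>)) = of_real (\<tau> powr (- \<beta> - 1)) * of_real \<tau> * of_real \<tau>"
        by (metis of_real_mult)
      show ?thesis unfolding f g W using True by simp
    qed simp
  qed
  also have "\<dots> = g' * h' * pair_kernel \<beta> (mp_ratio y z) (mp_ratio y w)"
    unfolding pair_kernel_def by (rule set_integral_mult_right)
  finally show "cov_kernel \<alpha> c y z w = of_real (y * c * (\<beta> * (\<beta> - 1)) / Gamma (2 - \<beta>)) *
      (deriv (\<lambda>z. z * mp_stieltjes y z) z * deriv (\<lambda>z. z * mp_stieltjes y z) w *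
       pair_kernel \<beta> (mp_ratio y z) (mp_ratio y w))"
    unfolding k_def g' .
qed

lemma cov_kernel_eq_formula:
  assumes \<alpha>: "2 < \<alpha>" "\<alpha> < 4" and y: "y > 0" and z: "z \<notin> \<real>" and w: "w \<notin> \<real>" and "z \<noteq> w"
  shows "cov_kernel \<alpha> c y z w = cov_formula \<alpha> c y z w"
proof -
  define \<beta> where "\<beta> = \<alpha> / 2"
  have \<beta>: "1 < \<beta>" "\<beta> < 2" using \<alpha> by (auto simp: \<beta>_def)
  define g' h' where g': "g' = deriv (\<lambda>z. z * mp_stieltjes y z) z" "h' = deriv (\<lambda>z. z * mp_stieltjes y z) w"
  define u v where u: "u = mp_ratio y z" "v = mp_ratio y w"
  have "u \<noteq> v" using mp_ratio_inj[OF y z w] \<open>z \<noteq> w\<close> by (auto simp: u)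
  have slit: "u \<notin> \<real>\<^sub>\<le>\<^sub>0" "v \<notin> \<real>\<^sub>\<le>\<^sub>0"
    using mp_ratio_properties(4)[OF y] z w by (auto simp: u)
  have "Gamma (2 - \<beta>) > 0" using \<beta> by (intro Gamma_real_pos) auto
  hence G0: "Gamma (2 - \<beta>) \<noteq> 0" by simp
  have "\<beta> \<notin> \<int>\<^sub>\<le>\<^sub>0" "\<beta> - 1 \<notin> \<int>\<^sub>\<le>\<^sub>0" using \<beta> by (auto dest: nonpos_Ints_nonpos)
  hence "Gamma (1 + \<beta>) = \<beta> * (\<beta> - 1) * Gamma (\<beta> - 1)"
    using Gamma_plus1[of \<beta>] Gamma_plus1[of "\<beta> - 1"] by (simp add: add.commute)
  hence const: "y * c * (\<beta> * (\<beta> - 1)) / Gamma (2 - \<beta>) * (Gamma (2 - \<beta>) * Gamma (\<beta> - 1)) = y * c * Gamma (1 + \<beta>)"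
    using G0 by simp
  have "cov_kernel \<alpha> c y z w = of_real (y * c * (\<beta> * (\<beta> - 1)) / Gamma (2 - \<beta>)) * (g' * h' *
      (of_real (Gamma (2 - \<beta>) * Gamma (\<beta> - 1)) *
       ((u powr of_real (\<beta> - 1) - v powr of_real (\<beta> - 1)) / (u - v))))"
    unfolding cov_kernel_eq(2)[OF \<alpha> y z w] \<beta>_def[symmetric] u[symmetric] g'[symmetric]
      pair_kernel_eq[OF \<beta> slit \<open>u \<noteq> v\<close>] ..
  also have "\<dots> = of_real (y * c * Gamma (1 + \<beta>)) * (g' * h' *
       ((u powr of_real (\<beta> - 1) - v powr of_real (\<beta> - 1)) / (u - v)))"
    unfolding const[symmetric] of_real_mult by (simp only: mult_ac)
  also have "\<dots> = cov_formula \<alpha> c y z w"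
  proof -
    have d: "z * mp_stieltjes y z - w * mp_stieltjes y w = - (u - v)"
      by (simp add: u mp_ratio_def)
    show ?thesis
      unfolding cov_formula_def g'[symmetric] d mp_ratio_def[symmetric] u[symmetric] \<beta>_def[symmetric] divide_minus_right
      by simp
  qed
  finally show ?thesis .
qed

theorem theorem2p2:
  fixes \<alpha> c y :: real and z w :: complex
  assumes "2 < \<alpha>" and "\<alpha> < 4" and "0 < c" and "0 < y"
    and "z \<notin> \<real>" and "w \<notin> \<real>"
  shows "set_integrable lborel ({0<..} \<times> {0<..}) (cov_integrand \<alpha> c y z w) \<and>
    (z \<noteq> w \<longrightarrow> cov_kernel \<alpha> c y z w = cov_formula \<alpha> c y z w) \<and>
    (z = w \<longrightarrow> (cov_formula \<alpha> c y z \<longlongrightarrow> cov_kernel \<alpha> c y z w) (at w))"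
proof (intro conjI impI)
  show "set_integrable lborel ({0<..} \<times> {0<..}) (cov_integrand \<alpha> c y z w)"
    using assms by (intro cov_kernel_eq(1))
  show "cov_kernel \<alpha> c y z w = cov_formula \<alpha> c y z w" if "z \<noteq> w"
    using assms that by (intro cov_kernel_eq_formula)
  show "(cov_formula \<alpha> c y z \<longlongrightarrow> cov_kernel \<alpha> c y z w) (at w)" if "z = w"
  proof (rule Lim_transform_eventually)
    \<comment> \<open>The regular form of the kernel is continuous in \<open>w\<close>, and it agrees with the quotient off the diagonal.\<close>
    let ?g' = "deriv (\<lambda>z. z * mp_stieltjes y z)" and ?\<beta> = "\<alpha> / 2"
    let ?K = "\<lambda>w. of_real (y * c * (?\<beta> * (?\<beta> - 1)) / Gamma (2 - ?\<beta>)) *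
      (?g' z * ?g' w * pair_kernel ?\<beta> (mp_ratio y z) (mp_ratio y w))"
    have K: "cov_kernel \<alpha> c y z w = ?K w" if "w \<notin> \<real>" for w
      using assms that by (intro cov_kernel_eq(2))
    have op: "open (- \<real> :: complex set)" using closed_complex_Reals by (rule open_Compl)
    have slit: "mp_ratio y v \<in> - \<real>\<^sub>\<le>\<^sub>0" if "v \<notin> \<real>" for v
      using mp_ratio_properties(4)[OF \<open>0 < y\<close> that refl] by simp
    have "?g' holomorphic_on - \<real>"
      using z_mp_stieltjes_holomorphic[OF \<open>0 < y\<close>] op by (rule holomorphic_deriv)
    moreover have "(\<lambda>w. pair_kernel ?\<beta> (mp_ratio y z) (mp_ratio y w)) holomorphic_on - \<real>"
    proof -
      have 1: "mp_ratio y holomorphic_on - \<real>"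
        unfolding mp_ratio_def[abs_def] using z_mp_stieltjes_holomorphic[OF \<open>0 < y\<close>]
        by (intro holomorphic_on_diff holomorphic_on_const)
      have 2: "pair_kernel ?\<beta> (mp_ratio y z) holomorphic_on - \<real>\<^sub>\<le>\<^sub>0"
        using assms slit[of z] by (intro pair_kernel_holomorphic) auto
      have "mp_ratio y ` (- \<real>) \<subseteq> - \<real>\<^sub>\<le>\<^sub>0" using slit by auto
      from holomorphic_on_compose_gen[OF 1 2 this] show ?thesis by (simp add: comp_def)
    qed
    ultimately have "?K holomorphic_on - \<real>"
      by (intro holomorphic_on_mult holomorphic_on_const)
    hence "isCont ?K w"
      using assms op by (meson ComplI continuous_on_eq_continuous_at holomorphic_on_imp_continuous_on)
    thus "(?K \<longlongrightarrow> cov_kernel \<alpha> c y z w) (at w)"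
      unfolding K[OF \<open>w \<notin> \<real>\<close>] by (simp add: isCont_def)
    have "\<forall>\<^sub>F v in at w. v \<in> - \<real> - {w}"
      using op assms(6) by (intro eventually_at_in_open) auto
    thus "\<forall>\<^sub>F v in at w. ?K v = cov_formula \<alpha> c y z v"
    proof eventually_elim
      fix v assume v: "v \<in> - \<real> - {w}"
      hence "cov_kernel \<alpha> c y z v = cov_formula \<alpha> c y z v"
        using assms \<open>z = w\<close> by (intro cov_kernel_eq_formula) auto
      moreover have "cov_kernel \<alpha> c y z v = ?K v" using v by (intro K) auto
      ultimately show "?K v = cov_formula \<alpha> c y z v" by (simp only:)
    qed
  qed
qed

end
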